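(* Let $n\ge 2$ be an integer and let $\mathfrak{B}_n(q,z)$ be the $q$-Brauer algebra over $\mathbb{Q}(q,z)$ with generators $H_1,\dots,H_{n-1},e$. There is a unique involutive ring homomorphism $\overline{\,\cdot\,}:\mathfrak{B}_n(q,z)\to\mathfrak{B}_n(q,z)$ which is $\mathbb{Q}$-linear and satisfies $\overline{q}=q^{-1}$, $\overline{z}=z^{-1}$, $\overline{H_i}=H_i^{-1}$ for $1\le i\le n-1$, and $\overline{e}=e$.
   Context: Here $q,z$ are invertible indeterminates. For $n\ge 2$, the $q$-Brauer algebra $\mathfrak{B}_n(q,z)$ is the unital associative $\mathbb{Q}(q,z)$-algebra with generators $H_1,\dots,H_{n-1},e$ and the following relations (each imposed whenever the generators appearing in it exist): (Q1) $(H_i-q)(H_i+q^{-1})=0$; (Q2) $H_iH_{i+1}H_i=H_{i+1}H_iH_{i+1}$; (Q3) $H_iH_j=H_jH_i$ for $|i-j|>1$; (Q4) $e^2=\frac{z-z^{-1}}{q-q^{-1}}\,e$; (Q5) $H_1e=eH_1=qe$; (Q6) $eH_2e=ze$; (Q7) $H_ie=eH_i$ for $i>2$; (Q8) $H_2H_3H_1^{-1}H_2^{-1}e_{(2)}=e_{(2)}=e_{(2)}H_2H_3H_1^{-1}H_2^{-1}$, where $e_{(2)}=e(H_2H_3H_1^{-1}H_2^{-1})e$. By (Q1) each $H_i$ is invertible. *)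

theory Defs
  imports
    "HOL-Computational_Algebra.Polynomial"
    "HOL-Computational_Algebra.Fraction_Field"
    "HOL-Library.Poly_Mapping"
    "HOL-Library.FuncSet"
    "HOL-Algebra.QuotRing"
begin

section \<open>The ground field\<close>

text \<open>
  The field of rational functions in two variables: the fraction field of the iterated polynomial
  ring, where the inner polynomial variable plays the role of $q$ and the outer one that of $z$.
\<close>

type_synonym qz = "rat poly poly fract"

definition qvar :: qz where
  "qvar = Fract [:[:0, 1:]:] 1"

definition zvar :: qz where
  "zvar = Fract [:0, 1:] 1"

definition rat_const :: "rat \<Rightarrow> qz" where
  "rat_const r = Fract [:[:r:]:] 1"


section \<open>The free associative algebra\<close>

datatype gen = Hgen nat | Egen

text \<open>
  Words in the generators, with concatenation written additively, because \<open>poly_mapping\<close> takes its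
  convolution product over an additive (not necessarily commutative) monoid of exponents. Thus
  \<open>word \<Rightarrow>\<^sub>0 qz\<close> is the free associative unital algebra on all of \<open>gen\<close>, and the empty
  word \<open>0\<close> is the basis element \<open>1\<close>.
\<close>

datatype word = Word (letters: "gen list")

instantiation word :: monoid_add
begin

definition zero_word :: word where
  "0 = Word []"

definition plus_word :: "word \<Rightarrow> word \<Rightarrow> word" where
  "u + v = Word (letters u @ letters v)"

instance
  by standard (simp_all add: zero_word_def plus_word_def)

end

type_synonym nc_poly = "word \<Rightarrow>\<^sub>0 qz"

definition scal :: "qz \<Rightarrow> nc_poly" where
  "scal c = Poly_Mapping.single 0 c"

definition gen_poly :: "gen \<Rightarrow> nc_poly" where
  "gen_poly g = Poly_Mapping.single (Word [g]) 1"

abbreviation Hp :: "nat \<Rightarrow> nc_poly" where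
  "Hp i \<equiv> gen_poly (Hgen i)"

abbreviation Ep :: nc_poly where
  "Ep \<equiv> gen_poly Egen"

definition gens :: "nat \<Rightarrow> gen set" where
  "gens n = Hgen ` {1..n - 1} \<union> {Egen}"

definition free_alg :: "nat \<Rightarrow> nc_poly ring" where
  "free_alg n =
     \<lparr>carrier = {p. \<forall>w \<in> Poly_Mapping.keys p. set (letters w) \<subseteq> gens n},
      mult = (*), one = 1, zero = 0, add = (+)\<rparr>"


section \<open>The $q$-Brauer algebra\<close>

text \<open>
  By the quadratic relation, the inverse of $H_i$ is $H_i - (q - q^{-1})$. This polynomial
  represents $H_i^{-1}$ in the relations; see \<open>qB_H_inv\<close> below.
\<close>

definition Hpinv :: "nat \<Rightarrow> nc_poly" where
  "Hpinv i = Hp i - scal (qvar - inverse qvar)"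

definition braid4 :: nc_poly where
  "braid4 = Hp 2 * Hp 3 * Hpinv 1 * Hpinv 2"

definition Ep2 :: nc_poly where
  "Ep2 = Ep * braid4 * Ep"

text \<open>
  A pair \<open>(a, b)\<close> stands for the relation $a = b$. The bounds on \<open>n\<close> say that
  the generators occurring in the relation exist, that is, that their indices are less than \<open>n\<close>.
\<close>

inductive_set relations :: "nat \<Rightarrow> (nc_poly \<times> nc_poly) set" for n :: nat where
  Q1: "1 \<le> i \<Longrightarrow> i < n \<Longrightarrow>
        ((Hp i - scal qvar) * (Hp i + scal (inverse qvar)), 0) \<in> relations n"
| Q2: "1 \<le> i \<Longrightarrow> i + 1 < n \<Longrightarrow>
        (Hp i * Hp (i + 1) * Hp i, Hp (i + 1) * Hp i * Hp (i + 1)) \<in> relations n"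
| Q3: "1 \<le> i \<Longrightarrow> i < n \<Longrightarrow> 1 \<le> j \<Longrightarrow> j < n \<Longrightarrow> \<bar>int i - int j\<bar> > 1 \<Longrightarrow>
        (Hp i * Hp j, Hp j * Hp i) \<in> relations n"
| Q4: "(Ep * Ep, scal ((zvar - inverse zvar) / (qvar - inverse qvar)) * Ep) \<in> relations n"
| Q5_left: "1 < n \<Longrightarrow> (Hp 1 * Ep, scal qvar * Ep) \<in> relations n"
| Q5_right: "1 < n \<Longrightarrow> (Ep * Hp 1, scal qvar * Ep) \<in> relations n"
| Q6: "2 < n \<Longrightarrow> (Ep * Hp 2 * Ep, scal zvar * Ep) \<in> relations n"
| Q7: "2 < i \<Longrightarrow> i < n \<Longrightarrow> (Hp i * Ep, Ep * Hp i) \<in> relations n"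
| Q8_left: "3 < n \<Longrightarrow> (braid4 * Ep2, Ep2) \<in> relations n"
| Q8_right: "3 < n \<Longrightarrow> (Ep2 * braid4, Ep2) \<in> relations n"

definition rel_ideal :: "nat \<Rightarrow> nc_poly set" where
  "rel_ideal n = genideal (free_alg n) {a - b | a b. (a, b) \<in> relations n}"

definition qBrauer :: "nat \<Rightarrow> nc_poly set ring" where
  "qBrauer n = free_alg n Quot rel_ideal n"

definition qB_class :: "nat \<Rightarrow> nc_poly \<Rightarrow> nc_poly set" where
  "qB_class n p = rel_ideal n +>\<^bsub>free_alg n\<^esub> p"

definition qB_scalar :: "nat \<Rightarrow> qz \<Rightarrow> nc_poly set" where
  "qB_scalar n c = qB_class n (scal c)"

definition qB_smult :: "nat \<Rightarrow> qz \<Rightarrow> nc_poly set \<Rightarrow> nc_poly set" where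
  "qB_smult n c x = qB_scalar n c \<otimes>\<^bsub>qBrauer n\<^esub> x"

definition qB_H :: "nat \<Rightarrow> nat \<Rightarrow> nc_poly set" where
  "qB_H n i = qB_class n (Hp i)"

definition qB_e :: "nat \<Rightarrow> nc_poly set" where
  "qB_e n = qB_class n Ep"


section \<open>Basic facts\<close>

lemma qvar_nonzero: "qvar \<noteq> 0"
  by (simp add: qvar_def Zero_fract_def eq_fract)

lemma qvar_minus_inverse_nonzero: "qvar - inverse qvar \<noteq> 0"
proof
  assume "qvar - inverse qvar = 0"
  then have "qvar * qvar = 1"
    using qvar_nonzero by (metis eq_iff_diff_eq_0 right_inverse)
  then show False
    by (simp add: qvar_def One_fract_def eq_fract one_pCons)
qed

lemma carrier_scal: "scal c \<in> carrier (free_alg n)"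
  by (auto simp: scal_def free_alg_def zero_word_def)

lemma carrier_gen: "g \<in> gens n \<Longrightarrow> gen_poly g \<in> carrier (free_alg n)"
  by (auto simp: gen_poly_def free_alg_def)

lemma carrier_plus:
  "a \<in> carrier (free_alg n) \<Longrightarrow> b \<in> carrier (free_alg n) \<Longrightarrow> a + b \<in> carrier (free_alg n)"
  using Poly_Mapping.keys_add[of a b] by (fastforce simp: free_alg_def)

lemma keys_minus_eq: "Poly_Mapping.keys (- a) = Poly_Mapping.keys (a :: nc_poly)"
  by (auto simp: in_keys_iff)

lemma carrier_uminus:
  "a \<in> carrier (free_alg n) \<Longrightarrow> - a \<in> carrier (free_alg n)"
  by (simp add: free_alg_def keys_minus_eq)

lemma carrier_minus:
  "a \<in> carrier (free_alg n) \<Longrightarrow> b \<in> carrier (free_alg n) \<Longrightarrow> a - b \<in> carrier (free_alg n)"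
  using carrier_plus[of a n "- b"] carrier_uminus[of b n] by simp

lemma carrier_times:
  "a \<in> carrier (free_alg n) \<Longrightarrow> b \<in> carrier (free_alg n) \<Longrightarrow> a * b \<in> carrier (free_alg n)"
  using Poly_Mapping.keys_mult[of a b] by (fastforce simp: free_alg_def plus_word_def)

lemma carrier_zero: "0 \<in> carrier (free_alg n)"
  by (simp add: free_alg_def)

lemma carrier_one: "1 \<in> carrier (free_alg n)"
  by (simp add: free_alg_def zero_word_def)

lemma free_alg_ops:
  "mult (free_alg n) = (*)" "one (free_alg n) = 1" "zero (free_alg n) = 0"
  "add (free_alg n) = (+)"
  by (simp_all add: free_alg_def)

lemma free_alg_ring: "ring (free_alg n)"
proof (rule ringI)
  show "abelian_group (free_alg n)"
  proof (rule abelian_groupI, unfold free_alg_ops)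
    show "\<exists>y\<in>carrier (free_alg n). y + x = 0" if "x \<in> carrier (free_alg n)" for x
      using carrier_uminus[OF that] by (intro bexI[of _ "- x"]) simp_all
  qed (simp_all add: carrier_plus carrier_zero add.assoc add.commute)
  show "monoid (free_alg n)"
    by (rule monoidI, unfold free_alg_ops)
      (simp_all add: carrier_times carrier_one mult.assoc)
qed (simp_all add: free_alg_ops distrib_left distrib_right)

lemma carrier_Hp: "1 \<le> i \<Longrightarrow> i < n \<Longrightarrow> Hp i \<in> carrier (free_alg n)"
  by (rule carrier_gen) (auto simp: gens_def)

lemma carrier_Ep: "Ep \<in> carrier (free_alg n)"
  by (rule carrier_gen) (auto simp: gens_def)

lemma carrier_Hpinv: "1 \<le> i \<Longrightarrow> i < n \<Longrightarrow> Hpinv i \<in> carrier (free_alg n)"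
  unfolding Hpinv_def by (intro carrier_minus carrier_Hp carrier_scal)

lemma carrier_relations:
  "(a, b) \<in> relations n \<Longrightarrow> a \<in> carrier (free_alg n) \<and> b \<in> carrier (free_alg n)"
  by (induction rule: relations.induct)
    (auto simp: Ep2_def braid4_def
      intro!: carrier_plus carrier_minus carrier_times carrier_scal carrier_zero
        carrier_Hp carrier_Ep carrier_Hpinv)

lemma rel_ideal_ideal: "ideal (rel_ideal n) (free_alg n)"
  unfolding rel_ideal_def
  by (rule ring.genideal_ideal[OF free_alg_ring]) (auto dest: carrier_relations intro: carrier_minus)

lemma qBrauer_ring: "ring (qBrauer n)"
  unfolding qBrauer_def by (rule ideal.quotient_is_ring[OF rel_ideal_ideal])

lemma qB_class_hom: "qB_class n \<in> ring_hom (free_alg n) (qBrauer n)"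
  unfolding qBrauer_def qB_class_def[abs_def] by (rule ideal.rcos_ring_hom[OF rel_ideal_ideal])

lemma qB_class_relation:
  assumes "(a, b) \<in> relations n"
  shows "qB_class n a = qB_class n b"
proof -
  interpret ideal "rel_ideal n" "free_alg n" by (rule rel_ideal_ideal)
  have c: "a \<in> carrier (free_alg n)" "b \<in> carrier (free_alg n)"
    using carrier_relations[OF assms] by auto
  have "a - b \<in> rel_ideal n"
    unfolding rel_ideal_def
    by (rule subsetD[OF genideal_self])
      (use assms carrier_relations in \<open>auto intro: carrier_minus\<close>)
  moreover have "a = (a - b) \<oplus>\<^bsub>free_alg n\<^esub> b"
    by (simp add: free_alg_def)
  ultimately have "a \<in> rel_ideal n +>\<^bsub>free_alg n\<^esub> b"
    unfolding a_r_coset_def' by blast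
  then show ?thesis
    unfolding qB_class_def using a_repr_independence[OF _ c(2) a_subgroup] by simp
qed

lemma scal_gen_commute: "scal c * gen_poly g = gen_poly g * scal c"
  by (simp add: scal_def gen_poly_def mult_single)

lemma qB_H_inv:
  assumes "1 \<le> i" "i < n"
  shows "inv\<^bsub>qBrauer n\<^esub> (qB_H n i) = qB_class n (Hpinv i)"
    and "qB_H n i \<in> Units (qBrauer n)"
proof -
  interpret B: ring "qBrauer n" by (rule qBrauer_ring)
  note hom = qB_class_hom[of n]
  have cH: "Hp i \<in> carrier (free_alg n)" "Hpinv i \<in> carrier (free_alg n)"
    using assms by (auto intro: carrier_Hp carrier_Hpinv)
  let ?P = "(Hp i - scal qvar) * (Hp i + scal (inverse qvar))"
  have qq: "scal qvar * scal (inverse qvar) = 1"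
    using qvar_nonzero by (simp add: scal_def mult_single)
  have d: "scal (qvar - inverse qvar) = scal qvar - scal (inverse qvar)"
    by (simp add: scal_def single_diff)
  have P: "Hp i * Hpinv i = ?P + 1" "Hpinv i * Hp i = ?P + 1"
    using qq scal_gen_commute[of qvar "Hgen i"] scal_gen_commute[of "inverse qvar" "Hgen i"]
    by (simp_all add: Hpinv_def d algebra_simps)
  have cP: "?P \<in> carrier (free_alg n)"
    by (intro carrier_times carrier_minus carrier_plus cH carrier_scal)
  have "qB_class n (?P + 1) = qB_class n ?P \<oplus>\<^bsub>qBrauer n\<^esub> qB_class n 1"
    using ring_hom_add[OF hom cP carrier_one] by (simp add: free_alg_def)
  also have "qB_class n ?P = qB_class n 0"
    using qB_class_relation[OF relations.Q1[OF assms]] .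
  also have "qB_class n 0 \<oplus>\<^bsub>qBrauer n\<^esub> qB_class n 1 = qB_class n 1"
    using ring_hom_add[OF hom carrier_zero carrier_one] by (simp add: free_alg_def)
  also have "\<dots> = \<one>\<^bsub>qBrauer n\<^esub>"
    using ring_hom_one[OF hom] by (simp add: free_alg_def)
  finally have one: "qB_class n (?P + 1) = \<one>\<^bsub>qBrauer n\<^esub>" .
  have r: "qB_H n i \<otimes>\<^bsub>qBrauer n\<^esub> qB_class n (Hpinv i) = \<one>\<^bsub>qBrauer n\<^esub>"
    using ring_hom_mult[OF hom cH(1) cH(2)] P(1) one by (simp add: free_alg_def qB_H_def)
  have l: "qB_class n (Hpinv i) \<otimes>\<^bsub>qBrauer n\<^esub> qB_H n i = \<one>\<^bsub>qBrauer n\<^esub>"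
    using ring_hom_mult[OF hom cH(2) cH(1)] P(2) one by (simp add: free_alg_def qB_H_def)
  have c: "qB_H n i \<in> carrier (qBrauer n)" "qB_class n (Hpinv i) \<in> carrier (qBrauer n)"
    unfolding qB_H_def using cH ring_hom_closed[OF hom] by auto
  show "inv\<^bsub>qBrauer n\<^esub> (qB_H n i) = qB_class n (Hpinv i)"
    using B.inv_char[OF c] r l by simp
  show "qB_H n i \<in> Units (qBrauer n)"
    using c r l by (auto simp: Units_def)
qed

end

theory Submission
  imports Defs
begin

text \<open>
  The bar is built on the free algebra and then passed to the quotient. Evaluating a rational
  function at $(q^{-1}, z^{-1})$ is an involutive automorphism of the ground field. With it, the
  free algebra has a unique semilinear ring endomorphism that sends $H_i$ to
  $H_i^{-1} = H_i - (q - q^{-1})$ and fixes $e$ (\<open>free_bar\<close>), and this endomorphism is an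
  involution before any relation is imposed. So existence comes down to showing that it maps
  the ideal of relations to itself.

  For (Q1)-(Q7) the image of a relation is, after expanding $H_i^{-1}$, a short linear combination
  of relations. The substance is in (Q8). Write $w = H_2 H_3 H_1^{-1} H_2^{-1}$ and
  $\overline{w} = H_2^{-1} H_3^{-1} H_1 H_2$. Expanding all inverses shows that
  $e_{(2)} = e w e$ is fixed by the bar (\<open>free_bar_Ep2\<close>), so it remains to see that
  $\overline{w}$ fixes $e_{(2)}$ as well. From $w e_{(2)} = e_{(2)}$ and the braid relations one
  gets $H_3 e_{(2)} = H_1 e_{(2)} = q e_{(2)}$ and then $H_1 H_2 e_{(2)} = H_3 H_2 e_{(2)}$, so that
  $\overline{w} e_{(2)} = H_2^{-1} H_3^{-1} H_3 H_2 e_{(2)} = e_{(2)}$; the argument on the right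
  is similar.

  Uniqueness holds because a ring homomorphism is determined by its values on the rational
  constants, $q$, $z$ and the generators (\<open>qBrauer_hom_ext\<close>).
\<close>

section \<open>The involution of the ground field\<close>

locale unital_ring_hom =
  fixes h :: "'a::ring_1 \<Rightarrow> 'b::ring_1"
  assumes hom_one: "h 1 = 1"
    and hom_add: "h (a + b) = h a + h b"
    and hom_mult: "h (a * b) = h a * h b"
begin

lemma hom_zero: "h 0 = 0"
  using hom_add[of 0 0] by simp

lemma hom_uminus: "h (- a) = - h a"
  using hom_add[of a "- a"] by (simp add: hom_zero eq_neg_iff_add_eq_0 add.commute)

lemma hom_diff: "h (a - b) = h a - h b"
  using hom_add[of a "- b"] by (simp add: hom_uminus)

end

lemma unital_ring_hom_poly_eval:
  fixes h :: "'a::comm_ring_1 \<Rightarrow> 'b::comm_ring_1"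
  assumes "unital_ring_hom h"
  shows "unital_ring_hom (\<lambda>p. poly (map_poly h p) x)"
proof -
  interpret unital_ring_hom h by fact
  let ?E = "\<lambda>p. poly (map_poly h p) x"
  have pCons: "?E (pCons a p) = h a + x * ?E p" for a p
    by (simp add: map_poly_pCons hom_zero)
  have add: "?E (p + q) = ?E p + ?E q" for p q
    by (induction p q rule: poly_induct2) (simp_all add: pCons hom_add algebra_simps)
  have smult: "?E (Polynomial.smult a p) = h a * ?E p" for a p
    by (induction p) (simp_all add: pCons hom_mult algebra_simps)
  have mult: "?E (p * q) = ?E p * ?E q" for p q
    by (induction p) (simp_all add: mult_pCons_left add smult pCons hom_zero algebra_simps)
  show ?thesis
    by unfold_locales (use add mult pCons[of 1 0] in \<open>simp_all add: one_pCons hom_one\<close>)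
qed

definition eval_poly_poly ::
    "('a::comm_ring_1 \<Rightarrow> 'b::comm_ring_1) \<Rightarrow> 'b \<Rightarrow> 'b \<Rightarrow> 'a poly poly \<Rightarrow> 'b" where
  "eval_poly_poly h x y = (\<lambda>P. poly (map_poly (\<lambda>p. poly (map_poly h p) x) P) y)"

lemma eval_poly_poly_hom:
  assumes "unital_ring_hom h"
  shows "unital_ring_hom (eval_poly_poly h x y)"
  unfolding eval_poly_poly_def by (intro unital_ring_hom_poly_eval assms)

lemma eval_poly_poly_const:
  assumes "unital_ring_hom h"
  shows "eval_poly_poly h x y [:[:a:]:] = h a"
  using unital_ring_hom.hom_zero[OF assms] by (simp add: eval_poly_poly_def map_poly_pCons)

lemma eval_poly_poly_vars:
  assumes "unital_ring_hom h"
  shows "eval_poly_poly h x y [:[:0, 1:]:] = x" "eval_poly_poly h x y [:0, 1:] = y"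
  using unital_ring_hom.hom_zero[OF assms] unital_ring_hom.hom_one[OF assms]
  by (simp_all add: eval_poly_poly_def map_poly_pCons one_pCons)

text \<open>
  Two Horner decompositions, one for each variable, show that constants and variables generate
  the ring. The rule hides the nesting of the two polynomial types, so that the variables can be
  treated alike.
\<close>

lemma poly_poly_induct [case_names const inner outer add mult]:
  fixes P :: "'a::comm_ring_1 poly poly \<Rightarrow> bool"
  assumes const: "\<And>a. P [:[:a:]:]"
    and inner: "P [:[:0, 1:]:]"
    and outer: "P [:0, 1:]"
    and add: "\<And>p q. P p \<Longrightarrow> P q \<Longrightarrow> P (p + q)"
    and mult: "\<And>p q. P p \<Longrightarrow> P q \<Longrightarrow> P (p * q)"
  shows "P p"
proof (induction p)
  case 0
  show ?case using const[of 0] by simp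
next
  case (pCons a p)
  have "P [:a:]"
  proof (induction a)
    case 0
    show ?case using const[of 0] by simp
  next
    case (pCons r a)
    have "[:pCons r a:] = [:[:r:]:] + [:[:0, 1:]:] * [:a:]"
      by simp
    then show ?case
      using pCons const inner add mult by metis
  qed
  moreover have "pCons a p = [:a:] + [:0, 1:] * p"
    by simp
  ultimately show ?case
    using pCons outer add mult by metis
qed

text \<open>
  The extension of an injective homomorphism from an integral domain to its field of fractions.
  Injectivity keeps the denominators nonzero, and then all representations of \<open>x\<close> give the
  same value.
\<close>

definition fract_lift :: "('a::idom \<Rightarrow> 'b::field) \<Rightarrow> 'a fract \<Rightarrow> 'b" where
  "fract_lift h x = (THE y. \<exists>a b. b \<noteq> 0 \<and> x = Fract a b \<and> y = h a / h b)"

lemma fract_lift_Fract: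
  fixes h :: "'a::idom \<Rightarrow> 'b::field"
  assumes "unital_ring_hom h" and inj: "\<And>a. h a = 0 \<Longrightarrow> a = 0" and "b \<noteq> 0"
  shows "fract_lift h (Fract a b) = h a / h b"
  unfolding fract_lift_def
proof (rule the_equality)
  show "\<exists>a' b'. b' \<noteq> 0 \<and> Fract a b = Fract a' b' \<and> h a / h b = h a' / h b'"
    using assms(3) by blast
  fix y assume "\<exists>a' b'. b' \<noteq> 0 \<and> Fract a b = Fract a' b' \<and> y = h a' / h b'"
  then obtain a' b' where 1: "b' \<noteq> 0" "Fract a b = Fract a' b'" "y = h a' / h b'"
    by blast
  then have "a * b' = a' * b"
    using assms(3) by (simp add: eq_fract)
  then have "h a * h b' = h a' * h b"
    using unital_ring_hom.hom_mult[OF assms(1)] by metis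
  moreover have "h b \<noteq> 0" "h b' \<noteq> 0"
    using inj assms(3) 1(1) by blast+
  ultimately show "y = h a / h b"
    using 1(3) by (simp add: frac_eq_eq)
qed

lemma fract_lift_hom:
  fixes h :: "'a::idom \<Rightarrow> 'b::field"
  assumes "unital_ring_hom h" and inj: "\<And>a. h a = 0 \<Longrightarrow> a = 0"
  shows "unital_ring_hom (fract_lift h)"
proof -
  interpret unital_ring_hom h by fact
  note lift = fract_lift_Fract[OF assms]
  have nz: "h b \<noteq> 0" if "b \<noteq> 0" for b
    using inj that by blast
  show ?thesis
  proof
    show "fract_lift h 1 = 1"
      by (simp add: One_fract_def lift hom_one)
    fix x y :: "'a fract"
    obtain a b where x: "x = Fract a b" "b \<noteq> 0" by (cases x)
    obtain c d where y: "y = Fract c d" "d \<noteq> 0" by (cases y)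
    show "fract_lift h (x + y) = fract_lift h x + fract_lift h y"
      using x y nz by (simp add: lift hom_add hom_mult add_frac_eq)
    show "fract_lift h (x * y) = fract_lift h x * fract_lift h y"
      using x y by (simp add: lift hom_mult)
  qed
qed

lemma fract_embedding_hom: "unital_ring_hom (\<lambda>a::'a::idom. Fract a 1)"
  by unfold_locales (simp_all add: One_fract_def)

lemma rat_const_hom: "unital_ring_hom rat_const"
  by unfold_locales (simp_all add: rat_const_def One_fract_def one_pCons)

text \<open>
  The ground field is generated by \<open>qvar\<close> and \<open>zvar\<close> as a field
  over the rationals. This yields both that the bar on scalars is an involution and that a ring
  homomorphism is determined on scalars by its values on rational constants, $q$ and $z$.
\<close>

lemma qz_induct [case_names rat qvar zvar add mult inverse]:
  assumes rat: "\<And>r. P (rat_const r)"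
    and qvar: "P qvar"
    and zvar: "P zvar"
    and add: "\<And>x y. P x \<Longrightarrow> P y \<Longrightarrow> P (x + y)"
    and mult: "\<And>x y. P x \<Longrightarrow> P y \<Longrightarrow> P (x * y)"
    and inverse: "\<And>x. x \<noteq> 0 \<Longrightarrow> P x \<Longrightarrow> P (inverse x)"
  shows "P x"
proof -
  have poly: "P (Fract p 1)" for p
  proof (induction p rule: poly_poly_induct)
    case (add p q)
    then show ?case using assms(4)[of "Fract p 1" "Fract q 1"] by simp
  next
    case (mult p q)
    then show ?case using assms(5)[of "Fract p 1" "Fract q 1"] by simp
  qed (use rat qvar zvar in \<open>simp_all add: rat_const_def qvar_def zvar_def\<close>)
  obtain a b where x: "x = Fract a b" "b \<noteq> 0" by (cases x)
  then have "x = Fract a 1 * inverse (Fract b 1)" "Fract b 1 \<noteq> 0"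
    by (simp_all add: eq_fract Zero_fract_def)
  then show ?thesis
    using mult[OF poly inverse[OF _ poly]] by simp
qed

definition invert_vars :: "rat poly poly \<Rightarrow> qz" where
  "invert_vars = eval_poly_poly rat_const (inverse qvar) (inverse zvar)"

lemma zvar_nonzero: "zvar \<noteq> 0"
  by (simp add: zvar_def Zero_fract_def eq_fract)

interpretation invert_vars: unital_ring_hom invert_vars
  unfolding invert_vars_def by (rule eval_poly_poly_hom[OF rat_const_hom])

lemma invert_vars_simps:
  "invert_vars [:[:r:]:] = rat_const r"
  "invert_vars [:[:0, 1:]:] = inverse qvar"
  "invert_vars [:0, 1:] = inverse zvar"
  unfolding invert_vars_def by (rule eval_poly_poly_const[OF rat_const_hom] eval_poly_poly_vars[OF rat_const_hom])+

text \<open>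
  Some monomial \<open>m\<close> clears the denominators of $p(q^{-1}, z^{-1})$; what remains is, up to
  a monomial factor, \<open>p\<close> with its coefficients read backwards, and reading backwards twice
  gives \<open>p\<close> back. Only one property of the monomial matters, that inverting the variables
  inverts it. In this form the conditions are symmetric in \<open>p\<close> and \<open>p'\<close>, and a
  common denominator of two polynomials is just the product of theirs, which avoids any
  bookkeeping of degrees.
\<close>

lemma invert_vars_reversal:
  "\<exists>m p'. invert_vars m * Fract m 1 = 1 \<and>
     invert_vars p * Fract m 1 = Fract p' 1 \<and> invert_vars p' * Fract m 1 = Fract p 1"
proof (induction p rule: poly_poly_induct)
  case (const r)
  show ?case
    by (rule exI[of _ 1], rule exI[of _ "[:[:r:]:]"])
      (simp add: invert_vars.hom_one invert_vars_simps rat_const_def flip: One_fract_def)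
next
  case inner
  show ?case
    by (rule exI[of _ "[:[:0, 1:]:]"], rule exI[of _ 1])
      (use qvar_nonzero in \<open>simp add: invert_vars.hom_one invert_vars_simps flip: qvar_def One_fract_def\<close>)
next
  case outer
  show ?case
    by (rule exI[of _ "[:0, 1:]"], rule exI[of _ 1])
      (use zvar_nonzero in \<open>simp add: invert_vars.hom_one invert_vars_simps flip: zvar_def One_fract_def\<close>)
next
  case (add p q)
  interpret emb: unital_ring_hom "\<lambda>a::rat poly poly. Fract a 1" by (rule fract_embedding_hom)
  obtain m p' where p: "invert_vars m * Fract m 1 = 1"
    "invert_vars p * Fract m 1 = Fract p' 1" "invert_vars p' * Fract m 1 = Fract p 1"
    using add by blast
  obtain k q' where q: "invert_vars k * Fract k 1 = 1"
    "invert_vars q * Fract k 1 = Fract q' 1" "invert_vars q' * Fract k 1 = Fract q 1"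
    using add by blast
  have 1: "invert_vars (m * k) * Fract (m * k) 1 = 1"
    using arg_cong2[OF p(1) q(1), of times] unfolding invert_vars.hom_mult emb.hom_mult
    by (simp only: mult_ac mult_1)
  have 2: "invert_vars (p + q) * Fract (m * k) 1 = Fract (p' * k + q' * m) 1"
    unfolding invert_vars.hom_add emb.hom_add emb.hom_mult p(2)[symmetric] q(2)[symmetric]
    by (simp only: algebra_simps)
  have 3: "invert_vars (p' * k + q' * m) * Fract (m * k) 1 = Fract (p + q) 1"
  proof -
    have "invert_vars (p' * k + q' * m) * Fract (m * k) 1
        = invert_vars p' * Fract m 1 * (invert_vars k * Fract k 1)
          + invert_vars q' * Fract k 1 * (invert_vars m * Fract m 1)"
      unfolding invert_vars.hom_add invert_vars.hom_mult emb.hom_mult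
      by (simp only: algebra_simps)
    also have "\<dots> = Fract (p + q) 1"
      by (simp add: p q)
    finally show ?thesis .
  qed
  show ?case
    using 1 2 3 by blast
next
  case (mult p q)
  interpret emb: unital_ring_hom "\<lambda>a::rat poly poly. Fract a 1" by (rule fract_embedding_hom)
  obtain m p' where p: "invert_vars m * Fract m 1 = 1"
    "invert_vars p * Fract m 1 = Fract p' 1" "invert_vars p' * Fract m 1 = Fract p 1"
    using mult by blast
  obtain k q' where q: "invert_vars k * Fract k 1 = 1"
    "invert_vars q * Fract k 1 = Fract q' 1" "invert_vars q' * Fract k 1 = Fract q 1"
    using mult by blast
  have 1: "invert_vars (m * k) * Fract (m * k) 1 = 1"
    using arg_cong2[OF p(1) q(1), of times] unfolding invert_vars.hom_mult emb.hom_mult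
    by (simp only: mult_ac mult_1)
  have 2: "invert_vars (p * q) * Fract (m * k) 1 = Fract (p' * q') 1"
    unfolding invert_vars.hom_mult emb.hom_mult p(2)[symmetric] q(2)[symmetric]
    by (simp only: algebra_simps)
  have 3: "invert_vars (p' * q') * Fract (m * k) 1 = Fract (p * q) 1"
    unfolding invert_vars.hom_mult emb.hom_mult p(3)[symmetric] q(3)[symmetric]
    by (simp only: algebra_simps)
  show ?case
    using 1 2 3 by blast
qed

text \<open>
  If the value at $(q^{-1}, z^{-1})$ vanishes, so does the reversed polynomial, and \<open>p\<close>
  is recovered from it.
\<close>

lemma invert_vars_inj: "invert_vars p = 0 \<Longrightarrow> p = 0"
proof -
  assume "invert_vars p = 0"
  moreover obtain m p' where "invert_vars p * Fract m 1 = Fract p' 1"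
    "invert_vars p' * Fract m 1 = Fract p 1"
    using invert_vars_reversal by blast
  ultimately have "Fract p 1 = 0"
    by (auto simp: Zero_fract_def eq_fract invert_vars.hom_zero)
  then show "p = 0"
    by (simp add: Zero_fract_def eq_fract)
qed

definition qz_bar :: "qz \<Rightarrow> qz" where
  "qz_bar = fract_lift invert_vars"

interpretation qz_bar: unital_ring_hom qz_bar
  unfolding qz_bar_def by (rule fract_lift_hom[OF invert_vars.unital_ring_hom_axioms invert_vars_inj])

lemma qz_bar_inverse: "qz_bar (inverse x) = inverse (qz_bar x)"
proof (cases "x = 0")
  case False
  then have "qz_bar x * qz_bar (inverse x) = 1"
    by (simp add: qz_bar.hom_one flip: qz_bar.hom_mult)
  then show ?thesis
    by (simp add: inverse_unique)
qed (simp add: qz_bar.hom_zero)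

lemma qz_bar_simps:
  "qz_bar (rat_const r) = rat_const r"
  "qz_bar qvar = inverse qvar"
  "qz_bar zvar = inverse zvar"
proof -
  have "qz_bar (Fract p 1) = invert_vars p" for p
    using fract_lift_Fract[OF invert_vars.unital_ring_hom_axioms invert_vars_inj, of 1 p]
    by (simp add: qz_bar_def invert_vars.hom_one)
  from this[of "[:[:r:]:]"] this[of "[:[:0, 1:]:]"] this[of "[:0, 1:]"]
  show "qz_bar (rat_const r) = rat_const r" "qz_bar qvar = inverse qvar"
    "qz_bar zvar = inverse zvar"
    unfolding invert_vars_simps rat_const_def qvar_def zvar_def by this+
qed

lemma qz_bar_involution: "qz_bar (qz_bar x) = x"
  by (induction x rule: qz_induct)
    (simp_all add: qz_bar_simps qz_bar_inverse qz_bar.hom_add qz_bar.hom_mult)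

section \<open>The bar on the free algebra\<close>

lemma scal_hom: "unital_ring_hom scal"
  by unfold_locales (simp_all add: scal_def single_add mult_single)

lemma nc_poly_monomial_expansion:
  fixes p :: nc_poly
  shows "p = (\<Sum>w\<in>Poly_Mapping.keys p. Poly_Mapping.single w (Poly_Mapping.lookup p w))"
proof (rule poly_mapping_eqI)
  fix v
  have "Poly_Mapping.lookup (\<Sum>w\<in>Poly_Mapping.keys p. Poly_Mapping.single w (Poly_Mapping.lookup p w)) v
      = (\<Sum>w\<in>Poly_Mapping.keys p. if w = v then Poly_Mapping.lookup p w else 0)"
    by (simp add: lookup_sum lookup_single when_def)
  also have "\<dots> = Poly_Mapping.lookup p v"
    by (simp add: in_keys_iff)
  finally show "Poly_Mapping.lookup p v = Poly_Mapping.lookup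
      (\<Sum>w\<in>Poly_Mapping.keys p. Poly_Mapping.single w (Poly_Mapping.lookup p w)) v" ..
qed

lemma scal_central: "scal c * p = p * scal c"
proof -
  obtain K f where p: "p = (\<Sum>w\<in>K. Poly_Mapping.single w (f w))"
    using nc_poly_monomial_expansion by blast
  show ?thesis
    unfolding p by (simp add: scal_def sum_distrib_left sum_distrib_right mult_single mult.commute)
qed

lemma single_Word_Cons:
  "Poly_Mapping.single (Word (g # gs)) c = gen_poly g * Poly_Mapping.single (Word gs) c"
  by (simp add: gen_poly_def mult_single plus_word_def)

text \<open>
  Induction along the presentation: every element is a sum of scalar multiples of words in the
  generators. The closure assumptions carry membership in the algebra, so that the predicate may
  speak of residue classes, which are multiplicative only there.
\<close>

lemma free_alg_induct [consumes 1, case_names scal gen add mult]: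
  assumes p: "p \<in> carrier (free_alg n)"
    and scal: "\<And>c. P (scal c)"
    and gen: "\<And>g. g \<in> gens n \<Longrightarrow> P (gen_poly g)"
    and add: "\<And>p r. p \<in> carrier (free_alg n) \<Longrightarrow> r \<in> carrier (free_alg n) \<Longrightarrow>
      P p \<Longrightarrow> P r \<Longrightarrow> P (p + r)"
    and mult: "\<And>p r. p \<in> carrier (free_alg n) \<Longrightarrow> r \<in> carrier (free_alg n) \<Longrightarrow>
      P p \<Longrightarrow> P r \<Longrightarrow> P (p * r)"
  shows "P p"
proof -
  have word: "Poly_Mapping.single (Word gs) c \<in> carrier (free_alg n) \<and>
      P (Poly_Mapping.single (Word gs) c)" if "set gs \<subseteq> gens n" for gs c
    using that
  proof (induction gs)
    case Nil
    then show ?case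
      using scal[of c] carrier_scal[of c n] by (simp add: scal_def zero_word_def)
  next
    case (Cons g gs)
    then show ?case
      using gen[of g] carrier_gen[of g n] mult carrier_times by (simp add: single_Word_Cons)
  qed
  have mono: "Poly_Mapping.single w c \<in> carrier (free_alg n) \<and> P (Poly_Mapping.single w c)"
    if "w \<in> Poly_Mapping.keys p" for w c
    using word[of "letters w" c] p that by (auto simp: free_alg_def)
  have "sum f K \<in> carrier (free_alg n) \<and> P (sum f K)"
    if "\<And>w. w \<in> K \<Longrightarrow> f w \<in> carrier (free_alg n) \<and> P (f w)" "finite K" for f and K :: "word set"
    using that(2,1)
  proof (induction K rule: finite_induct)
    case empty
    then show ?case
      using scal[of 0] carrier_zero[of n] by (simp add: scal_def)
  next
    case (insert w K)
    then show ?case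
      using add carrier_plus by simp
  qed
  from this[of "Poly_Mapping.keys p" "\<lambda>w. Poly_Mapping.single w (Poly_Mapping.lookup p w)"] mono
  show ?thesis
    by (simp flip: nc_poly_monomial_expansion)
qed

text \<open>
  The universal property of the free algebra, relative to a map \<open>s\<close> of
  coefficients: the generator \<open>x\<close> goes to \<open>g x\<close>.
\<close>

definition semilinear_ext :: "(qz \<Rightarrow> qz) \<Rightarrow> (gen \<Rightarrow> nc_poly) \<Rightarrow> nc_poly \<Rightarrow> nc_poly" where
  "semilinear_ext s g p = (\<Sum>w\<in>Poly_Mapping.keys p.
     scal (s (Poly_Mapping.lookup p w)) * prod_list (map g (letters w)))"

context
  fixes s :: "qz \<Rightarrow> qz" and g :: "gen \<Rightarrow> nc_poly"
  assumes s: "unital_ring_hom s"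
begin

interpretation s: unital_ring_hom s by (rule s)
interpretation scal: unital_ring_hom scal by (rule scal_hom)

lemma semilinear_ext_single:
  "semilinear_ext s g (Poly_Mapping.single w c) = scal (s c) * prod_list (map g (letters w))"
  by (simp add: semilinear_ext_def s.hom_zero scal.hom_zero)

lemma semilinear_ext_scal: "semilinear_ext s g (scal c) = scal (s c)"
  unfolding scal_def[of c] by (simp add: semilinear_ext_single zero_word_def)

lemma semilinear_ext_gen: "semilinear_ext s g (gen_poly x) = g x"
  unfolding gen_poly_def by (simp add: semilinear_ext_single s.hom_one scal.hom_one)

lemma semilinear_ext_superset:
  assumes "finite K" "Poly_Mapping.keys p \<subseteq> K"
  shows "semilinear_ext s g p =
    (\<Sum>w\<in>K. scal (s (Poly_Mapping.lookup p w)) * prod_list (map g (letters w)))"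
  unfolding semilinear_ext_def
  by (rule sum.mono_neutral_left) (use assms in \<open>auto simp: in_keys_iff s.hom_zero scal.hom_zero\<close>)

lemma semilinear_ext_add: "semilinear_ext s g (p + r) = semilinear_ext s g p + semilinear_ext s g r"
proof -
  let ?K = "Poly_Mapping.keys p \<union> Poly_Mapping.keys r"
  have "finite ?K" "Poly_Mapping.keys (p + r) \<subseteq> ?K"
    by (simp_all add: Poly_Mapping.keys_add)
  then show ?thesis
    by (simp add: semilinear_ext_superset[of ?K] lookup_add s.hom_add scal.hom_add
        distrib_right sum.distrib)
qed

lemma semilinear_ext_sum: "semilinear_ext s g (sum f A) = (\<Sum>a\<in>A. semilinear_ext s g (f a))"
proof -
  have "semilinear_ext s g 0 = 0"
    by (simp add: semilinear_ext_def)
  then show ?thesis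
    by (induction A rule: infinite_finite_induct) (simp_all add: semilinear_ext_add)
qed

text \<open>
  On monomials this uses that scalars are central: the coefficient of the second factor has to
  pass the image of the first word. Additivity extends it to all elements.
\<close>

lemma semilinear_ext_mult: "semilinear_ext s g (p * r) = semilinear_ext s g p * semilinear_ext s g r"
proof -
  have single: "semilinear_ext s g (Poly_Mapping.single v a * Poly_Mapping.single w b)
      = semilinear_ext s g (Poly_Mapping.single v a) * semilinear_ext s g (Poly_Mapping.single w b)"
    for v w a b
  proof -
    let ?G = "\<lambda>w. prod_list (map g (letters w))"
    have "scal (s a) * scal (s b) * (?G v * ?G w) = scal (s a) * (scal (s b) * ?G v) * ?G w"
      by (simp only: mult.assoc)
    also have "\<dots> = scal (s a) * ?G v * (scal (s b) * ?G w)"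
      by (simp only: scal_central[of "s b" "?G v"] mult.assoc)
    finally show ?thesis
      by (simp add: mult_single semilinear_ext_single plus_word_def s.hom_mult scal.hom_mult)
  qed
  obtain K c where p: "p = (\<Sum>w\<in>K. Poly_Mapping.single w (c w))"
    using nc_poly_monomial_expansion by blast
  obtain L d where r: "r = (\<Sum>w\<in>L. Poly_Mapping.single w (d w))"
    using nc_poly_monomial_expansion by blast
  show ?thesis
    unfolding p r by (simp only: sum_distrib_left sum_distrib_right semilinear_ext_sum single)
qed

lemma semilinear_ext_hom: "unital_ring_hom (semilinear_ext s g)"
  using semilinear_ext_scal[of 1]
  by unfold_locales (simp_all add: s.hom_one scal.hom_one semilinear_ext_add semilinear_ext_mult)

end

fun bar_gen :: "gen \<Rightarrow> nc_poly" where
  "bar_gen (Hgen i) = Hpinv i"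
| "bar_gen Egen = Ep"

definition free_bar :: "nc_poly \<Rightarrow> nc_poly" where
  "free_bar = semilinear_ext qz_bar bar_gen"

interpretation free_bar: unital_ring_hom free_bar
  unfolding free_bar_def by (rule semilinear_ext_hom[OF qz_bar.unital_ring_hom_axioms])

interpretation scal: unital_ring_hom scal
  by (rule scal_hom)

lemma free_bar_scal: "free_bar (scal c) = scal (qz_bar c)"
  and free_bar_Hp: "free_bar (Hp i) = Hpinv i"
  and free_bar_Ep: "free_bar Ep = Ep"
  unfolding free_bar_def
  by (simp_all add: semilinear_ext_scal semilinear_ext_gen qz_bar.unital_ring_hom_axioms)

lemma free_bar_Hpinv: "free_bar (Hpinv i) = Hp i"
  by (simp add: Hpinv_def free_bar.hom_diff free_bar_Hp free_bar_scal qz_bar.hom_diff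
      qz_bar_inverse qz_bar_simps scal.hom_diff)

lemma gens_cases:
  assumes "g \<in> gens n"
  obtains i where "g = Hgen i" "1 \<le> i" "i < n" | "g = Egen"
  using assms by (force simp: gens_def)

lemma free_bar_closed: "p \<in> carrier (free_alg n) \<Longrightarrow> free_bar p \<in> carrier (free_alg n)"
proof (induction p rule: free_alg_induct)
  case (gen g)
  then show ?case
    by (cases rule: gens_cases) (simp_all add: free_bar_Hp free_bar_Ep carrier_Hpinv carrier_Ep)
qed (simp_all add: free_bar_scal free_bar.hom_add free_bar.hom_mult
    carrier_scal carrier_plus carrier_times)

text \<open>
  This already holds in the free algebra, before any relation is imposed: since
  $q - q^{-1}$ changes its sign under the bar, \<open>Hpinv i\<close> goes back to \<open>Hp i\<close>.
\<close>

lemma free_bar_involution: "p \<in> carrier (free_alg n) \<Longrightarrow> free_bar (free_bar p) = p"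
proof (induction p rule: free_alg_induct)
  case (gen g)
  then show ?case
    by (cases rule: gens_cases) (simp_all add: free_bar_Hp free_bar_Hpinv free_bar_Ep)
qed (simp_all add: free_bar_scal qz_bar_involution free_bar.hom_add free_bar.hom_mult)

section \<open>Calculating modulo the relations\<close>

lemma rel_ideal_carrier: "a \<in> rel_ideal n \<Longrightarrow> a \<in> carrier (free_alg n)"
  using ideal.Icarr[OF rel_ideal_ideal] .

lemma rel_ideal_zero: "0 \<in> rel_ideal n"
  using additive_subgroup.zero_closed[OF ideal.axioms(1)[OF rel_ideal_ideal]]
  by (simp add: free_alg_ops)

lemma rel_ideal_add: "a \<in> rel_ideal n \<Longrightarrow> b \<in> rel_ideal n \<Longrightarrow> a + b \<in> rel_ideal n"
  using additive_subgroup.a_closed[OF ideal.axioms(1)[OF rel_ideal_ideal]]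
  by (simp add: free_alg_ops)

lemma rel_ideal_lmult: "a \<in> rel_ideal n \<Longrightarrow> x \<in> carrier (free_alg n) \<Longrightarrow> x * a \<in> rel_ideal n"
  using ideal.I_l_closed[OF rel_ideal_ideal] by (simp add: free_alg_ops)

lemma rel_ideal_rmult: "a \<in> rel_ideal n \<Longrightarrow> x \<in> carrier (free_alg n) \<Longrightarrow> a * x \<in> rel_ideal n"
  using ideal.I_r_closed[OF rel_ideal_ideal] by (simp add: free_alg_ops)

lemma rel_ideal_uminus: "a \<in> rel_ideal n \<Longrightarrow> - a \<in> rel_ideal n"
  using rel_ideal_lmult[of a n "- 1"] carrier_uminus[OF carrier_one] by simp

definition rel_cong :: "nat \<Rightarrow> nc_poly \<Rightarrow> nc_poly \<Rightarrow> bool" where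
  "rel_cong n a b \<longleftrightarrow> a - b \<in> rel_ideal n"

lemma rel_cong_relation: "(a, b) \<in> relations n \<Longrightarrow> rel_cong n a b"
  unfolding rel_cong_def rel_ideal_def
  by (rule subsetD[OF ring.genideal_self[OF free_alg_ring]])
    (auto dest: carrier_relations intro: carrier_minus)

lemma rel_cong_sym: "rel_cong n a b \<Longrightarrow> rel_cong n b a"
  using rel_ideal_uminus[of "a - b" n] by (simp add: rel_cong_def)

lemma rel_cong_trans [trans]: "rel_cong n a b \<Longrightarrow> rel_cong n b c \<Longrightarrow> rel_cong n a c"
  using rel_ideal_add[of "a - b" n "b - c"] by (simp add: rel_cong_def)

lemma rel_cong_add: "rel_cong n a b \<Longrightarrow> rel_cong n c d \<Longrightarrow> rel_cong n (a + c) (b + d)"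
  using rel_ideal_add[of "a - b" n "c - d"] by (simp add: rel_cong_def algebra_simps)

lemma rel_cong_uminus: "rel_cong n a b \<Longrightarrow> rel_cong n (- a) (- b)"
  using rel_ideal_uminus[of "a - b" n] by (simp add: rel_cong_def)

lemma rel_cong_diff: "rel_cong n a b \<Longrightarrow> rel_cong n c d \<Longrightarrow> rel_cong n (a - c) (b - d)"
  using rel_cong_add[of n a b "- c" "- d"] rel_cong_uminus by simp

lemma rel_cong_context:
  assumes "rel_cong n a b" "u \<in> carrier (free_alg n)" "v \<in> carrier (free_alg n)"
  shows "rel_cong n (u * a * v) (u * b * v)"
  using rel_ideal_rmult[OF rel_ideal_lmult[OF assms(1)[unfolded rel_cong_def] assms(2)] assms(3)]
  by (simp add: rel_cong_def algebra_simps)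

text \<open>
  The form in which congruences are used in calculations: rewriting a factor inside a product,
  where the context \<open>u\<close>, \<open>v\<close> selects the occurrence.
\<close>

lemma rel_cong_rewrite:
  assumes "rel_cong n a b" "p = u * a * v" "r = u * b * v"
    and "u \<in> carrier (free_alg n)" "v \<in> carrier (free_alg n)"
  shows "rel_cong n p r"
  using rel_cong_context[OF assms(1,4,5)] assms(2,3) by simp

lemmas carrier_rules = carrier_scal carrier_Hp carrier_Hpinv carrier_Ep carrier_zero carrier_one
  carrier_plus carrier_minus carrier_times

definition q_diff :: nc_poly where
  "q_diff = scal (qvar - inverse qvar)"

lemma Hpinv_eq: "Hpinv i = Hp i - q_diff"
  by (simp add: Hpinv_def q_diff_def)

lemma scal_push:
  "gen_poly g * scal c = scal c * gen_poly g"
  "gen_poly g * (scal c * p) = scal c * (gen_poly g * p)"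
  "Hpinv i * scal c = scal c * Hpinv i"
  "Hpinv i * (scal c * p) = scal c * (Hpinv i * p)"
  by (metis scal_central mult.assoc)+

lemma q_diff_push:
  "gen_poly g * q_diff = q_diff * gen_poly g"
  "gen_poly g * (q_diff * p) = q_diff * (gen_poly g * p)"
  unfolding q_diff_def by (rule scal_push)+

lemma scal_merge:
  "scal a * scal b = scal (a * b)"
  "scal a * (scal b * p) = scal (a * b) * p"
  by (simp_all add: scal.hom_mult mult.assoc)

lemma scal_commute: "scal a * scal b = scal b * scal a"
  by (rule scal_central)

lemma scal_left_commute: "scal a * (scal b * p) = scal b * (scal a * p)"
  by (metis scal_central mult.assoc)

lemma quadratic:
  assumes "1 \<le> i" "i < n"
  shows "rel_cong n (Hp i * Hp i) (q_diff * Hp i + 1)"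
proof -
  have "(Hp i - scal qvar) * (Hp i + scal (inverse qvar)) = Hp i * Hp i - (q_diff * Hp i + 1)"
    using qvar_nonzero
    by (simp add: q_diff_def scal.hom_diff scal_push scal_merge scal.hom_one algebra_simps)
  then show ?thesis
    using rel_cong_relation[OF relations.Q1[OF assms]] by (simp add: rel_cong_def)
qed

lemma Hp_Hpinv:
  assumes "1 \<le> i" "i < n"
  shows "rel_cong n (Hp i * Hpinv i) 1" "rel_cong n (Hpinv i * Hp i) 1"
  using quadratic[OF assms]
  by (simp_all add: rel_cong_def Hpinv_eq algebra_simps q_diff_push)

text \<open>
  After substituting $H^{-1} = H - (q - q^{-1})$ and expanding, each difference of the two sides is
  the difference of the braid relation minus $q - q^{-1}$ times the difference of the quadratic
  relations for \<open>i\<close> and \<open>j\<close>.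
\<close>

lemma twisted_braid:
  assumes braid: "rel_cong n (Hp i * Hp j * Hp i) (Hp j * Hp i * Hp j)"
    and "1 \<le> i" "i < n" "1 \<le> j" "j < n"
  shows "rel_cong n (Hpinv i * Hpinv j * Hp i) (Hp j * Hpinv i * Hpinv j)"
    and "rel_cong n (Hpinv i * Hpinv j * Hpinv i) (Hpinv j * Hpinv i * Hpinv j)"
proof -
  have "rel_cong n (Hp i * Hp i - Hp j * Hp j)
      ((q_diff * Hp i + 1) - (q_diff * Hp j + 1))"
    using assms by (intro rel_cong_diff quadratic)
  then have "rel_cong n (q_diff * (Hp i * Hp i - Hp j * Hp j) * 1)
      (q_diff * ((q_diff * Hp i + 1) - (q_diff * Hp j + 1)) * 1)"
    unfolding q_diff_def by (intro rel_cong_context carrier_rules)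
  from rel_cong_diff[OF braid this]
  show "rel_cong n (Hpinv i * Hpinv j * Hp i) (Hp j * Hpinv i * Hpinv j)"
    "rel_cong n (Hpinv i * Hpinv j * Hpinv i) (Hpinv j * Hpinv i * Hpinv j)"
    by (simp_all add: rel_cong_def Hpinv_eq algebra_simps q_diff_push)
qed

lemma Hpinv_commute:
  assumes "rel_cong n (Hp i * Hp j) (Hp j * Hp i)"
  shows "rel_cong n (Hpinv i * Hpinv j) (Hpinv j * Hpinv i)"
    and "rel_cong n (Hpinv i * Hp j) (Hp j * Hpinv i)"
  using assms by (simp_all add: rel_cong_def Hpinv_eq algebra_simps q_diff_push)

lemma H1_Ep_inverse:
  assumes "1 < n"
  shows "rel_cong n (Hpinv 1 * Ep) (scal (inverse qvar) * Ep)"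
    and "rel_cong n (Ep * Hpinv 1) (scal (inverse qvar) * Ep)"
  using rel_cong_relation[OF relations.Q5_left[OF assms]] rel_cong_relation[OF relations.Q5_right[OF assms]]
  by (simp_all add: rel_cong_def Hpinv_eq algebra_simps q_diff_push,
      simp_all add: q_diff_def scal.hom_diff algebra_simps)

section \<open>The element $e_{(2)}$ and the bar\<close>

context
  fixes n :: nat
  assumes n: "3 < n"
begin

private abbreviation (input) rel_cong_n (infix "\<approx>" 50) where
  "a \<approx> b \<equiv> rel_cong n a b"

lemma index_bounds: "1 < n" "2 < n"
  using n by simp_all

lemma Hp_closed: "Hp 1 \<in> carrier (free_alg n)" "Hp 2 \<in> carrier (free_alg n)" "Hp 3 \<in> carrier (free_alg n)"
  "Hpinv 1 \<in> carrier (free_alg n)" "Hpinv 2 \<in> carrier (free_alg n)" "Hpinv 3 \<in> carrier (free_alg n)"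
  using n by (auto intro!: carrier_Hp carrier_Hpinv)

lemma braid4_closed: "braid4 \<in> carrier (free_alg n)"
  unfolding braid4_def by (intro carrier_times Hp_closed)

lemma Ep2_closed: "Ep2 \<in> carrier (free_alg n)"
  unfolding Ep2_def by (intro carrier_times carrier_Ep braid4_closed)

(* The simplifier turns the index 1 into Suc 0, hence the second copy of the first fact. *)
lemmas carriers = Hp_closed Hp_closed[unfolded One_nat_def] braid4_closed Ep2_closed
  carrier_scal carrier_Ep carrier_one carrier_times

lemma braid_12: "Hp 1 * Hp 2 * Hp 1 \<approx> Hp 2 * Hp 1 * Hp 2"
  using rel_cong_relation[OF relations.Q2[of 1 n]] n by (simp add: numeral_2_eq_2)

lemma braid_23: "Hp 2 * Hp 3 * Hp 2 \<approx> Hp 3 * Hp 2 * Hp 3"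
  using rel_cong_relation[OF relations.Q2[of 2 n]] n by simp

lemma commute_13: "Hp 1 * Hp 3 \<approx> Hp 3 * Hp 1"
  using rel_cong_relation[OF relations.Q3[of 1 n 3]] n by simp

lemma H1_Ep: "Hp 1 * Ep \<approx> scal qvar * Ep"
  and Ep_H1: "Ep * Hp 1 \<approx> scal qvar * Ep"
  and Ep_H2_Ep: "Ep * Hp 2 * Ep \<approx> scal zvar * Ep"
  and H3_Ep: "Hp 3 * Ep \<approx> Ep * Hp 3"
  and braid4_Ep2: "braid4 * Ep2 \<approx> Ep2"
  and Ep2_braid4: "Ep2 * braid4 \<approx> Ep2"
  by (rule rel_cong_relation, rule relations.intros; use n in simp)+

text \<open>
  The next lemmas evaluate the words between two copies of $e$ that occur when $e_{(2)}$ and its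
  image under the bar are expanded. In each of them, possibly after a braid relation, $H_3$ can be
  pulled out past $e$ and $H_1$ be absorbed into $e$, which leaves $e H_2 e = z e$.
\<close>

lemma Ep_H232_Ep:
  "Ep * Hp 2 * Hp 3 * Hp 2 * Ep \<approx> scal zvar * Ep * (q_diff * Hp 3 + 1)"
proof -
  have "Ep * Hp 2 * Hp 3 * Hp 2 * Ep \<approx> Ep * Hp 3 * Hp 2 * Hp 3 * Ep"
    by (rule rel_cong_rewrite[OF braid_23, of _ Ep Ep]) (simp_all add: mult.assoc carriers)
  also have "\<dots> \<approx> Ep * Hp 3 * Hp 2 * Ep * Hp 3"
    by (rule rel_cong_rewrite[OF H3_Ep, of _ "Ep * Hp 3 * Hp 2" 1])
      (simp_all add: mult.assoc carriers)
  also have "\<dots> \<approx> Hp 3 * Ep * Hp 2 * Ep * Hp 3"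
    by (rule rel_cong_rewrite[OF rel_cong_sym[OF H3_Ep], of _ 1 "Hp 2 * Ep * Hp 3"])
      (simp_all add: mult.assoc carriers)
  also have "\<dots> \<approx> scal zvar * Hp 3 * Ep * Hp 3"
    by (rule rel_cong_rewrite[OF Ep_H2_Ep, of _ "Hp 3" "Hp 3"])
      (simp_all add: mult.assoc carriers scal_push)
  also have "\<dots> \<approx> scal zvar * Ep * (Hp 3 * Hp 3)"
    by (rule rel_cong_rewrite[OF H3_Ep, of _ "scal zvar" "Hp 3"])
      (simp_all add: mult.assoc carriers)
  also have "\<dots> \<approx> scal zvar * Ep * (q_diff * Hp 3 + 1)"
    by (rule rel_cong_rewrite[OF quadratic[of 3 n], of _ "scal zvar * Ep" 1])
      (use n in \<open>simp_all add: mult.assoc carriers\<close>)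
  finally show ?thesis .
qed

lemma Ep_H23_H1inv_Ep:
  "Ep * Hp 2 * Hp 3 * Hpinv 1 * Ep \<approx> scal (inverse qvar * zvar) * Ep * Hp 3"
proof -
  have "Ep * Hp 2 * Hp 3 * Hpinv 1 * Ep \<approx> scal (inverse qvar) * Ep * Hp 2 * Hp 3 * Ep"
    by (rule rel_cong_rewrite[OF H1_Ep_inverse(1)[OF index_bounds(1)], of _ "Ep * Hp 2 * Hp 3" 1])
      (simp_all add: mult.assoc carriers scal_push)
  also have "\<dots> \<approx> scal (inverse qvar) * Ep * Hp 2 * Ep * Hp 3"
    by (rule rel_cong_rewrite[OF H3_Ep, of _ "scal (inverse qvar) * Ep * Hp 2" 1])
      (simp_all add: mult.assoc carriers)
  also have "\<dots> \<approx> scal (inverse qvar * zvar) * Ep * Hp 3"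
    by (rule rel_cong_rewrite[OF Ep_H2_Ep, of _ "scal (inverse qvar)" "Hp 3"])
      (simp_all add: mult.assoc carriers scal_merge)
  finally show ?thesis .
qed

lemma Ep_H12_Ep: "Ep * Hp 1 * Hp 2 * Ep \<approx> scal (qvar * zvar) * Ep"
proof -
  have "Ep * Hp 1 * Hp 2 * Ep \<approx> scal qvar * Ep * Hp 2 * Ep"
    by (rule rel_cong_rewrite[OF Ep_H1, of _ 1 "Hp 2 * Ep"]) (simp_all add: mult.assoc carriers)
  also have "\<dots> \<approx> scal (qvar * zvar) * Ep"
    by (rule rel_cong_rewrite[OF Ep_H2_Ep, of _ "scal qvar" 1])
      (simp_all add: mult.assoc carriers scal_merge)
  finally show ?thesis .
qed

lemma Ep_H212_Ep: "Ep * Hp 2 * Hp 1 * Hp 2 * Ep \<approx> scal (qvar * qvar * zvar) * Ep"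
proof -
  have "Ep * Hp 2 * Hp 1 * Hp 2 * Ep \<approx> Ep * Hp 1 * Hp 2 * Hp 1 * Ep"
    by (rule rel_cong_rewrite[OF rel_cong_sym[OF braid_12], of _ Ep Ep])
      (simp_all add: mult.assoc carriers)
  also have "\<dots> \<approx> scal qvar * Ep * Hp 1 * Hp 2 * Ep"
    by (rule rel_cong_rewrite[OF H1_Ep, of _ "Ep * Hp 1 * Hp 2" 1])
      (simp_all add: mult.assoc carriers scal_push)
  also have "\<dots> \<approx> scal (qvar * qvar * zvar) * Ep"
    by (rule rel_cong_rewrite[OF Ep_H12_Ep, of _ "scal qvar" 1])
      (simp_all add: mult.assoc carriers scal_merge)
  finally show ?thesis .
qed

lemma Ep_H312_Ep: "Ep * Hp 3 * Hp 1 * Hp 2 * Ep \<approx> scal (qvar * zvar) * Ep * Hp 3"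
proof -
  have "Ep * Hp 3 * Hp 1 * Hp 2 * Ep \<approx> Hp 3 * Ep * Hp 1 * Hp 2 * Ep"
    by (rule rel_cong_rewrite[OF rel_cong_sym[OF H3_Ep], of _ 1 "Hp 1 * Hp 2 * Ep"])
      (simp_all add: mult.assoc carriers)
  also have "\<dots> \<approx> scal (qvar * zvar) * Hp 3 * Ep"
    by (rule rel_cong_rewrite[OF Ep_H12_Ep, of _ "Hp 3" 1])
      (simp_all add: mult.assoc carriers scal_push)
  also have "\<dots> \<approx> scal (qvar * zvar) * Ep * Hp 3"
    by (rule rel_cong_rewrite[OF H3_Ep, of _ "scal (qvar * zvar)" 1])
      (simp_all add: mult.assoc carriers)
  finally show ?thesis .
qed

lemma free_bar_braid4: "free_bar braid4 = Hpinv 2 * Hpinv 3 * Hp 1 * Hp 2"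
  by (simp add: braid4_def free_bar.hom_mult free_bar_Hp free_bar_Hpinv)

text \<open>
  The element $e_{(2)}$ is fixed by the bar. Its image is $e H_2^{-1} H_3^{-1} H_1 H_2 e$; when all
  inverses are expanded, the words of length four cancel in the difference, and the remaining ones
  are those evaluated above.
\<close>

lemma free_bar_Ep2: "free_bar Ep2 \<approx> Ep2"
proof -
  \<comment> \<open>The difference of the two elements is \<open>q_diff * ?lhs\<close>.\<close>
  let ?lhs = "Ep * Hp 2 * Hp 3 * Hp 2 * Ep + Ep * Hp 2 * Hp 3 * Hpinv 1 * Ep
    - Ep * Hp 2 * Hp 1 * Hp 2 * Ep - Ep * Hp 3 * Hp 1 * Hp 2 * Ep
    + q_diff * (Ep * Hp 1 * Hp 2 * Ep)"
  let ?rhs = "scal zvar * Ep * (q_diff * Hp 3 + 1) + scal (inverse qvar * zvar) * Ep * Hp 3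
    - scal (qvar * qvar * zvar) * Ep - scal (qvar * zvar) * Ep * Hp 3
    + q_diff * (scal (qvar * zvar) * Ep)"
  have "q_diff * (Ep * Hp 1 * Hp 2 * Ep) \<approx> q_diff * (scal (qvar * zvar) * Ep)"
    by (rule rel_cong_rewrite[OF Ep_H12_Ep, of _ q_diff 1]) (simp_all add: carriers q_diff_def)
  then have "?lhs \<approx> ?rhs"
    by (intro rel_cong_add rel_cong_diff Ep_H232_Ep Ep_H23_H1inv_Ep Ep_H212_Ep Ep_H312_Ep)
  moreover have "?rhs = 0"
  proof -
    have "?rhs = scal (zvar * (qvar - inverse qvar) + inverse qvar * zvar - qvar * zvar) * (Ep * Hp 3)
      + scal (zvar - qvar * qvar * zvar + (qvar - inverse qvar) * (qvar * zvar)) * Ep"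
      by (simp only: q_diff_def scal.hom_diff scal.hom_add scal.hom_mult scal_push
          scal_commute scal_left_commute distrib_left distrib_right left_diff_distrib
          right_diff_distrib mult.assoc mult_1_right) (simp add: algebra_simps)
    also have "zvar * (qvar - inverse qvar) + inverse qvar * zvar - qvar * zvar = 0"
      by (simp add: algebra_simps)
    also have "zvar - qvar * qvar * zvar + (qvar - inverse qvar) * (qvar * zvar) = 0"
      using qvar_nonzero by (simp add: algebra_simps)
    finally show ?thesis
      by (simp add: scal.hom_zero)
  qed
  ultimately have "q_diff * ?lhs * 1 \<approx> q_diff * 0 * 1"
    by (intro rel_cong_context) (simp_all add: q_diff_def carriers)
  moreover have "q_diff * ?lhs * 1 = free_bar Ep2 - Ep2"
    unfolding Ep2_def free_bar.hom_mult free_bar_braid4 free_bar_Ep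
    by (simp add: braid4_def Hpinv_eq algebra_simps q_diff_push)
  ultimately show ?thesis
    by (simp add: rel_cong_def)
qed

text \<open>
  Both $H_1$ and $H_3$ act on $e_{(2)}$, from either side, as the scalar $q$. For $H_1$ this is
  immediate. For $H_3$ it follows because $w = H_2 H_3 H_1^{-1} H_2^{-1}$ fixes $e_{(2)}$ and
  satisfies $H_3 w = w H_1$. From the right this is used as $w^{-1} H_3 = H_1 w^{-1}$, with
  $w^{-1} = H_2 H_1 H_3^{-1} H_2^{-1}$.
\<close>

lemma H1_Ep2: "Hp 1 * Ep2 \<approx> scal qvar * Ep2"
  unfolding Ep2_def
  by (rule rel_cong_rewrite[OF H1_Ep, of _ 1 "braid4 * Ep"]) (simp_all add: mult.assoc carriers)

lemma Ep2_H1: "Ep2 * Hp 1 \<approx> scal qvar * Ep2"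
  unfolding Ep2_def
  by (rule rel_cong_rewrite[OF Ep_H1, of _ "Ep * braid4" 1])
    (simp_all add: mult.assoc carriers braid4_def scal_push)

lemma H3_Ep2: "Hp 3 * Ep2 \<approx> scal qvar * Ep2"
proof -
  have "Hp 3 * Ep2 \<approx> Hp 3 * Hp 2 * Hp 3 * Hpinv 1 * Hpinv 2 * Ep2"
    by (rule rel_cong_rewrite[OF rel_cong_sym[OF braid4_Ep2], of _ "Hp 3" 1])
      (simp_all add: mult.assoc carriers braid4_def)
  also have "\<dots> \<approx> Hp 2 * Hp 3 * Hp 2 * Hpinv 1 * Hpinv 2 * Ep2"
    by (rule rel_cong_rewrite[OF rel_cong_sym[OF braid_23], of _ 1 "Hpinv 1 * Hpinv 2 * Ep2"])
      (simp_all add: mult.assoc carriers)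
  also have "\<dots> \<approx> Hp 2 * Hp 3 * Hpinv 1 * Hpinv 2 * Hp 1 * Ep2"
    by (rule rel_cong_rewrite[OF rel_cong_sym[OF twisted_braid(1)[OF braid_12]], of _ "Hp 2 * Hp 3" "Ep2"])
      (use n in \<open>simp_all add: mult.assoc carriers\<close>)
  also have "\<dots> \<approx> scal qvar * braid4 * Ep2"
    by (rule rel_cong_rewrite[OF H1_Ep2, of _ "Hp 2 * Hp 3 * Hpinv 1 * Hpinv 2" 1])
      (simp_all add: mult.assoc carriers braid4_def scal_push)
  also have "\<dots> \<approx> scal qvar * Ep2"
    by (rule rel_cong_rewrite[OF braid4_Ep2, of _ "scal qvar" 1]) (simp_all add: mult.assoc carriers)
  finally show ?thesis .
qed

lemma Ep2_braid4_inverse: "Ep2 \<approx> Ep2 * Hp 2 * Hp 1 * Hpinv 3 * Hpinv 2"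
proof -
  have "Ep2 * Hp 2 * Hp 1 * Hpinv 3 * Hpinv 2
      \<approx> Ep2 * Hp 2 * Hp 3 * Hpinv 1 * Hpinv 2 * Hp 2 * Hp 1 * Hpinv 3 * Hpinv 2"
    by (rule rel_cong_rewrite[OF rel_cong_sym[OF Ep2_braid4], of _ 1 "Hp 2 * Hp 1 * Hpinv 3 * Hpinv 2"])
      (simp_all add: mult.assoc carriers braid4_def)
  also have "\<dots> \<approx> Ep2 * Hp 2 * Hp 3 * Hpinv 1 * Hp 1 * Hpinv 3 * Hpinv 2"
    by (rule rel_cong_rewrite[OF Hp_Hpinv(2)[of 2 n], of _ "Ep2 * Hp 2 * Hp 3 * Hpinv 1" "Hp 1 * Hpinv 3 * Hpinv 2"])
      (use n in \<open>simp_all add: mult.assoc carriers\<close>)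
  also have "\<dots> \<approx> Ep2 * Hp 2 * Hp 3 * Hpinv 3 * Hpinv 2"
    by (rule rel_cong_rewrite[OF Hp_Hpinv(2)[of 1 n], of _ "Ep2 * Hp 2 * Hp 3" "Hpinv 3 * Hpinv 2"])
      (use n in \<open>simp_all add: mult.assoc carriers\<close>)
  also have "\<dots> \<approx> Ep2 * Hp 2 * Hpinv 2"
    by (rule rel_cong_rewrite[OF Hp_Hpinv(1)[of 3 n], of _ "Ep2 * Hp 2" "Hpinv 2"])
      (use n in \<open>simp_all add: mult.assoc carriers\<close>)
  also have "\<dots> \<approx> Ep2"
    by (rule rel_cong_rewrite[OF Hp_Hpinv(1)[of 2 n], of _ Ep2 1])
      (use n in \<open>simp_all add: mult.assoc carriers\<close>)
  finally show ?thesis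
    by (rule rel_cong_sym)
qed

lemma Ep2_H3: "Ep2 * Hp 3 \<approx> scal qvar * Ep2"
proof -
  have "Ep2 * Hp 3 \<approx> Ep2 * Hp 2 * Hp 1 * Hpinv 3 * Hpinv 2 * Hp 3"
    by (rule rel_cong_rewrite[OF Ep2_braid4_inverse, of _ 1 "Hp 3"])
      (simp_all add: mult.assoc carriers)
  also have "\<dots> \<approx> Ep2 * Hp 2 * Hp 1 * Hp 2 * Hpinv 3 * Hpinv 2"
    by (rule rel_cong_rewrite[OF twisted_braid(1)[OF rel_cong_sym[OF braid_23]], of _ "Ep2 * Hp 2 * Hp 1" 1])
      (use n in \<open>simp_all add: mult.assoc carriers\<close>)
  also have "\<dots> \<approx> Ep2 * Hp 1 * Hp 2 * Hp 1 * Hpinv 3 * Hpinv 2"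
    by (rule rel_cong_rewrite[OF rel_cong_sym[OF braid_12], of _ Ep2 "Hpinv 3 * Hpinv 2"])
      (simp_all add: mult.assoc carriers)
  also have "\<dots> \<approx> scal qvar * Ep2 * Hp 2 * Hp 1 * Hpinv 3 * Hpinv 2"
    by (rule rel_cong_rewrite[OF Ep2_H1, of _ 1 "Hp 2 * Hp 1 * Hpinv 3 * Hpinv 2"])
      (simp_all add: mult.assoc carriers)
  also have "\<dots> \<approx> scal qvar * Ep2"
    by (rule rel_cong_rewrite[OF rel_cong_sym[OF Ep2_braid4_inverse], of _ "scal qvar" 1])
      (simp_all add: mult.assoc carriers)
  finally show ?thesis .
qed

text \<open>
  Cancelling $H_2$ from $H_2 H_3 H_1^{-1} H_2^{-1} e_{(2)} = e_{(2)}$ gives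
  $H_1 H_2^{-1} e_{(2)} = H_3 H_2^{-1} e_{(2)}$. Replacing $H_2^{-1}$ by $H_2$ adds multiples of
  $H_1 e_{(2)}$ and $H_3 e_{(2)}$, which agree.
\<close>

lemma H12_Ep2: "Hp 1 * Hp 2 * Ep2 \<approx> Hp 3 * Hp 2 * Ep2"
proof -
  have "Hp 1 * Hpinv 2 * Ep2 \<approx> Hp 1 * Hpinv 2 * Hp 2 * Hp 3 * Hpinv 1 * Hpinv 2 * Ep2"
    by (rule rel_cong_rewrite[OF rel_cong_sym[OF braid4_Ep2], of _ "Hp 1 * Hpinv 2" 1])
      (simp_all add: mult.assoc carriers braid4_def)
  also have "\<dots> \<approx> Hp 1 * Hp 3 * Hpinv 1 * Hpinv 2 * Ep2"
    by (rule rel_cong_rewrite[OF Hp_Hpinv(2)[of 2 n], of _ "Hp 1" "Hp 3 * Hpinv 1 * Hpinv 2 * Ep2"])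
      (use n in \<open>simp_all add: mult.assoc carriers\<close>)
  also have "\<dots> \<approx> Hp 3 * Hp 1 * Hpinv 1 * Hpinv 2 * Ep2"
    by (rule rel_cong_rewrite[OF commute_13, of _ 1 "Hpinv 1 * Hpinv 2 * Ep2"])
      (simp_all add: mult.assoc carriers)
  also have "\<dots> \<approx> Hp 3 * Hpinv 2 * Ep2"
    by (rule rel_cong_rewrite[OF Hp_Hpinv(1)[of 1 n], of _ "Hp 3" "Hpinv 2 * Ep2"])
      (use n in \<open>simp_all add: mult.assoc carriers\<close>)
  finally have inv: "Hp 1 * Hpinv 2 * Ep2 \<approx> Hp 3 * Hpinv 2 * Ep2" .
  have "Hp 1 * Ep2 \<approx> Hp 3 * Ep2"
    using rel_cong_trans[OF H1_Ep2 rel_cong_sym[OF H3_Ep2]] .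
  then have "q_diff * (Hp 1 * Ep2) * 1 \<approx> q_diff * (Hp 3 * Ep2) * 1"
    by (rule rel_cong_context) (simp_all add: q_diff_def carriers)
  from rel_cong_add[OF inv this] show ?thesis
    by (simp add: Hpinv_eq algebra_simps q_diff_push)
qed

lemma Ep2_H2inv_H1: "Ep2 * Hpinv 2 * Hp 1 \<approx> Ep2 * Hpinv 2 * Hp 3"
proof -
  have "Ep2 * Hp 2 * Hp 1 \<approx> Ep2 * Hp 2 * Hp 3 * Hpinv 1 * Hpinv 2 * Hp 2 * Hp 1"
    by (rule rel_cong_rewrite[OF rel_cong_sym[OF Ep2_braid4], of _ 1 "Hp 2 * Hp 1"])
      (simp_all add: mult.assoc carriers braid4_def)
  also have "\<dots> \<approx> Ep2 * Hp 2 * Hp 3 * Hpinv 1 * Hp 1"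
    by (rule rel_cong_rewrite[OF Hp_Hpinv(2)[of 2 n], of _ "Ep2 * Hp 2 * Hp 3 * Hpinv 1" "Hp 1"])
      (use n in \<open>simp_all add: mult.assoc carriers\<close>)
  also have "\<dots> \<approx> Ep2 * Hp 2 * Hp 3"
    by (rule rel_cong_rewrite[OF Hp_Hpinv(2)[of 1 n], of _ "Ep2 * Hp 2 * Hp 3" 1])
      (use n in \<open>simp_all add: mult.assoc carriers\<close>)
  finally have H2: "Ep2 * Hp 2 * Hp 1 \<approx> Ep2 * Hp 2 * Hp 3" .
  have "Ep2 * Hp 1 \<approx> Ep2 * Hp 3"
    using rel_cong_trans[OF Ep2_H1 rel_cong_sym[OF Ep2_H3]] .
  then have "q_diff * (Ep2 * Hp 1) * 1 \<approx> q_diff * (Ep2 * Hp 3) * 1"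
    by (rule rel_cong_context) (simp_all add: q_diff_def carriers)
  moreover have "Ep2 * (q_diff * p) = q_diff * (Ep2 * p)" for p
    unfolding q_diff_def by (metis scal_central mult.assoc)
  ultimately show ?thesis
    using rel_cong_diff[OF H2] by (simp add: Hpinv_eq algebra_simps q_diff_push)
qed

lemma free_bar_braid4_Ep2: "free_bar braid4 * Ep2 \<approx> Ep2"
proof -
  have "free_bar braid4 * Ep2 \<approx> Hpinv 2 * Hpinv 3 * Hp 3 * Hp 2 * Ep2"
    unfolding free_bar_braid4
    by (rule rel_cong_rewrite[OF H12_Ep2, of _ "Hpinv 2 * Hpinv 3" 1])
      (simp_all add: mult.assoc carriers)
  also have "\<dots> \<approx> Hpinv 2 * Hp 2 * Ep2"
    by (rule rel_cong_rewrite[OF Hp_Hpinv(2)[of 3 n], of _ "Hpinv 2" "Hp 2 * Ep2"])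
      (use n in \<open>simp_all add: mult.assoc carriers\<close>)
  also have "\<dots> \<approx> Ep2"
    by (rule rel_cong_rewrite[OF Hp_Hpinv(2)[of 2 n], of _ 1 Ep2])
      (use n in \<open>simp_all add: mult.assoc carriers\<close>)
  finally show ?thesis .
qed

lemma Ep2_free_bar_braid4: "Ep2 * free_bar braid4 \<approx> Ep2"
proof -
  have "Ep2 * free_bar braid4 \<approx> Ep2 * Hpinv 2 * Hp 1 * Hpinv 3 * Hp 2"
    unfolding free_bar_braid4
    by (rule rel_cong_rewrite[OF Hpinv_commute(2)[OF rel_cong_sym[OF commute_13]], of _ "Ep2 * Hpinv 2" "Hp 2"])
      (simp_all add: mult.assoc carriers)
  also have "\<dots> \<approx> Ep2 * Hpinv 2 * Hp 3 * Hpinv 3 * Hp 2"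
    by (rule rel_cong_rewrite[OF Ep2_H2inv_H1, of _ 1 "Hpinv 3 * Hp 2"])
      (simp_all add: mult.assoc carriers)
  also have "\<dots> \<approx> Ep2 * Hpinv 2 * Hp 2"
    by (rule rel_cong_rewrite[OF Hp_Hpinv(1)[of 3 n], of _ "Ep2 * Hpinv 2" "Hp 2"])
      (use n in \<open>simp_all add: mult.assoc carriers\<close>)
  also have "\<dots> \<approx> Ep2"
    by (rule rel_cong_rewrite[OF Hp_Hpinv(2)[of 2 n], of _ Ep2 1])
      (use n in \<open>simp_all add: mult.assoc carriers\<close>)
  finally show ?thesis .
qed

lemma free_bar_Q8:
  "free_bar (braid4 * Ep2) \<approx> free_bar Ep2"
  "free_bar (Ep2 * braid4) \<approx> free_bar Ep2"
proof -
  have c: "free_bar braid4 \<in> carrier (free_alg n)"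
    by (rule free_bar_closed[OF braid4_closed])
  have "free_bar braid4 * free_bar Ep2 * 1 \<approx> free_bar braid4 * Ep2 * 1"
    by (rule rel_cong_context[OF free_bar_Ep2 c carrier_one])
  also have "free_bar braid4 * Ep2 * 1 \<approx> Ep2"
    using free_bar_braid4_Ep2 by simp
  also have "Ep2 \<approx> free_bar Ep2"
    by (rule rel_cong_sym[OF free_bar_Ep2])
  finally show "free_bar (braid4 * Ep2) \<approx> free_bar Ep2"
    by (simp add: free_bar.hom_mult)
  have "1 * free_bar Ep2 * free_bar braid4 \<approx> 1 * Ep2 * free_bar braid4"
    by (rule rel_cong_context[OF free_bar_Ep2 carrier_one c])
  also have "1 * Ep2 * free_bar braid4 \<approx> Ep2"
    using Ep2_free_bar_braid4 by simp
  also have "Ep2 \<approx> free_bar Ep2"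
    by (rule rel_cong_sym[OF free_bar_Ep2])
  finally show "free_bar (Ep2 * braid4) \<approx> free_bar Ep2"
    by (simp add: free_bar.hom_mult)
qed

end

section \<open>The bar preserves the ideal of relations\<close>

text \<open>
  The bar sends each defining relation to a consequence of the defining relations. The quadratic
  relation is sent to itself; (Q6) needs the value of $e^2$ from (Q4), whose coefficient
  is invariant because numerator and denominator both change sign.
\<close>

lemma free_bar_relation:
  assumes "(a, b) \<in> relations n"
  shows "rel_cong n (free_bar a) (free_bar b)"
  using assms
proof cases
  case (Q1 i)
  have "Hpinv i - scal (inverse qvar) = Hp i - scal qvar"
    "Hpinv i + scal qvar = Hp i + scal (inverse qvar)"
    by (simp_all add: Hpinv_def scal.hom_diff)
  then have "free_bar a = a"
    using Q1(1) by (simp add: free_bar.hom_mult free_bar.hom_diff free_bar.hom_add free_bar_Hp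
        free_bar_scal qz_bar_simps qz_bar_inverse)
  then show ?thesis
    using rel_cong_relation[OF assms] Q1(2) by (simp add: free_bar.hom_zero)
next
  case (Q2 i)
  have "rel_cong n (Hp i * Hp (i + 1) * Hp i) (Hp (i + 1) * Hp i * Hp (i + 1))"
    using rel_cong_relation[OF assms] Q2 by simp
  from twisted_braid(2)[OF this] show ?thesis
    using Q2 by (simp add: free_bar.hom_mult free_bar_Hp)
next
  case (Q3 i j)
  have "rel_cong n (Hp i * Hp j) (Hp j * Hp i)"
    using rel_cong_relation[OF assms] Q3 by simp
  from Hpinv_commute(1)[OF this] show ?thesis
    using Q3 by (simp add: free_bar.hom_mult free_bar_Hp)
next
  case Q4
  have "qz_bar ((zvar - inverse zvar) / (qvar - inverse qvar))
      = (inverse zvar - zvar) / (inverse qvar - qvar)"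
    by (simp add: divide_inverse qz_bar.hom_mult qz_bar_inverse qz_bar.hom_diff qz_bar_simps)
  also have "\<dots> = (zvar - inverse zvar) / (qvar - inverse qvar)"
    by (metis minus_diff_eq minus_divide_divide)
  finally show ?thesis
    using rel_cong_relation[OF assms] Q4
    by (simp add: free_bar.hom_mult free_bar_Ep free_bar_scal)
next
  case Q5_left
  then show ?thesis
    using H1_Ep_inverse(1) by (simp add: free_bar.hom_mult free_bar_Hp free_bar_Ep free_bar_scal qz_bar_simps)
next
  case Q5_right
  then show ?thesis
    using H1_Ep_inverse(2) by (simp add: free_bar.hom_mult free_bar_Hp free_bar_Ep free_bar_scal qz_bar_simps)
next
  case Q6
  let ?\<delta> = "(zvar - inverse zvar) / (qvar - inverse qvar)"
  have Q4: "rel_cong n (q_diff * (Ep * Ep) * 1) (q_diff * (scal ?\<delta> * Ep) * 1)"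
    unfolding q_diff_def by (intro rel_cong_context rel_cong_relation relations.Q4 carrier_rules)
  have "rel_cong n (Ep * Hp 2 * Ep - q_diff * (Ep * Ep) * 1)
      (scal zvar * Ep - q_diff * (scal ?\<delta> * Ep) * 1)"
    using rel_cong_diff[OF rel_cong_relation[OF relations.Q6[OF Q6(3)]] Q4] .
  also have "scal zvar * Ep - q_diff * (scal ?\<delta> * Ep) * 1
      = scal (zvar - (qvar - inverse qvar) * ?\<delta>) * Ep"
    by (simp only: q_diff_def scal_merge scal.hom_diff[of zvar] left_diff_distrib mult_1_right)
  also have "zvar - (qvar - inverse qvar) * ?\<delta> = inverse zvar"
    using qvar_minus_inverse_nonzero by simp
  finally show ?thesis
    using Q6 by (simp add: free_bar.hom_mult free_bar_Hp free_bar_Ep free_bar_scal qz_bar_simps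
        Hpinv_eq algebra_simps q_diff_push)
next
  case (Q7 i)
  have "rel_cong n (Hp i * Ep) (Ep * Hp i)"
    using rel_cong_relation[OF assms] Q7 by simp
  then show ?thesis
    using Q7 by (simp add: free_bar.hom_mult free_bar_Hp free_bar_Ep rel_cong_def Hpinv_eq
        algebra_simps q_diff_push)
next
  case Q8_left
  then show ?thesis using free_bar_Q8(1) by simp
next
  case Q8_right
  then show ?thesis using free_bar_Q8(2) by simp
qed

text \<open>
  The elements that the bar sends into the ideal form an ideal themselves, and it contains the
  generators.
\<close>

lemma free_bar_rel_ideal:
  assumes "a \<in> rel_ideal n"
  shows "free_bar a \<in> rel_ideal n"
proof -
  interpret free_alg: ring "free_alg n" by (rule free_alg_ring)
  let ?J = "{a \<in> carrier (free_alg n). free_bar a \<in> rel_ideal n}"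
  have neg: "\<ominus>\<^bsub>free_alg n\<^esub> a = - a" if "a \<in> carrier (free_alg n)" for a
    using free_alg.minus_equality[of "- a" a] that carrier_uminus
    by (simp add: free_alg_ops)
  have "ideal ?J (free_alg n)"
  proof (rule idealI[OF free_alg_ring])
    show "subgroup ?J (add_monoid (free_alg n))"
    proof
      fix x assume "x \<in> ?J"
      then show "inv\<^bsub>add_monoid (free_alg n)\<^esub> x \<in> ?J"
        using neg[of x]
        by (auto simp: a_inv_def free_bar.hom_uminus intro: carrier_uminus rel_ideal_uminus)
    qed (auto simp: free_alg_ops free_bar.hom_add free_bar.hom_zero
        intro: carrier_plus carrier_zero rel_ideal_add rel_ideal_zero)
  qed (auto simp: free_alg_ops free_bar.hom_mult
      intro: carrier_times rel_ideal_lmult rel_ideal_rmult free_bar_closed)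
  moreover have "{a - b | a b. (a, b) \<in> relations n} \<subseteq> ?J"
    using free_bar_relation carrier_relations
    by (fastforce simp: rel_cong_def free_bar.hom_diff intro: carrier_minus)
  ultimately have "rel_ideal n \<subseteq> ?J"
    unfolding rel_ideal_def by (rule free_alg.genideal_minimal)
  then show ?thesis
    using assms by blast
qed

section \<open>The bar on the quotient\<close>

lemma qB_class_image: "qB_class n p = (\<lambda>h. h + p) ` rel_ideal n"
  by (auto simp: qB_class_def a_r_coset_def' free_alg_ops)

lemma carrier_qBrauer: "carrier (qBrauer n) = qB_class n ` carrier (free_alg n)"
  by (auto simp: qBrauer_def FactRing_def A_RCOSETS_def' qB_class_def)

lemma qB_class_add:
  assumes "p \<in> carrier (free_alg n)" "r \<in> carrier (free_alg n)"
  shows "qB_class n (p + r) = qB_class n p \<oplus>\<^bsub>qBrauer n\<^esub> qB_class n r"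
  using ring_hom_add[OF qB_class_hom assms] by (simp add: free_alg_ops)

lemma qB_class_mult:
  assumes "p \<in> carrier (free_alg n)" "r \<in> carrier (free_alg n)"
  shows "qB_class n (p * r) = qB_class n p \<otimes>\<^bsub>qBrauer n\<^esub> qB_class n r"
  using ring_hom_mult[OF qB_class_hom assms] by (simp add: free_alg_ops)

lemma qB_class_one: "qB_class n 1 = \<one>\<^bsub>qBrauer n\<^esub>"
  using ring_hom_one[OF qB_class_hom] by (simp add: free_alg_ops)

text \<open>
  An element of the quotient is a coset. Since the bar is bijective on the free algebra and
  preserves the ideal, it maps cosets onto cosets, so taking images elementwise needs no choice
  of representatives.
\<close>

definition qB_bar :: "nat \<Rightarrow> nc_poly set \<Rightarrow> nc_poly set" where
  "qB_bar n = (\<lambda>X \<in> carrier (qBrauer n). free_bar ` X)"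

lemma free_bar_image_rel_ideal: "free_bar ` rel_ideal n = rel_ideal n"
proof
  show "rel_ideal n \<subseteq> free_bar ` rel_ideal n"
  proof
    fix a assume "a \<in> rel_ideal n"
    then have "free_bar a \<in> rel_ideal n" "a = free_bar (free_bar a)"
      by (rule free_bar_rel_ideal, rule free_bar_involution[OF rel_ideal_carrier, symmetric])
    then show "a \<in> free_bar ` rel_ideal n"
      by (rule rev_image_eqI)
  qed
  show "free_bar ` rel_ideal n \<subseteq> rel_ideal n"
    by (rule image_subsetI) (rule free_bar_rel_ideal)
qed

lemma qB_bar_class:
  assumes "p \<in> carrier (free_alg n)"
  shows "qB_bar n (qB_class n p) = qB_class n (free_bar p)"
proof -
  have "free_bar ` qB_class n p = (\<lambda>h. h + free_bar p) ` free_bar ` rel_ideal n"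
    by (simp add: qB_class_image image_image free_bar.hom_add)
  then show ?thesis
    using assms by (simp add: qB_bar_def carrier_qBrauer free_bar_image_rel_ideal flip: qB_class_image)
qed

lemma qB_bar_hom: "qB_bar n \<in> ring_hom (qBrauer n) (qBrauer n)"
proof (rule ring_hom_memI)
  show "qB_bar n x \<in> carrier (qBrauer n)" if "x \<in> carrier (qBrauer n)" for x
    using that by (auto simp: carrier_qBrauer qB_bar_class intro: free_bar_closed)
  fix x y assume "x \<in> carrier (qBrauer n)" "y \<in> carrier (qBrauer n)"
  then obtain p r where p: "p \<in> carrier (free_alg n)" "x = qB_class n p"
    and r: "r \<in> carrier (free_alg n)" "y = qB_class n r"
    by (auto simp: carrier_qBrauer)
  note closed = p(1) r(1) free_bar_closed[OF p(1)] free_bar_closed[OF r(1)]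
  show "qB_bar n (x \<otimes>\<^bsub>qBrauer n\<^esub> y) = qB_bar n x \<otimes>\<^bsub>qBrauer n\<^esub> qB_bar n y"
    using qB_bar_class[OF carrier_times[OF p(1) r(1)]]
    by (simp only: p(2) r(2) qB_class_mult closed qB_bar_class free_bar.hom_mult)
  show "qB_bar n (x \<oplus>\<^bsub>qBrauer n\<^esub> y) = qB_bar n x \<oplus>\<^bsub>qBrauer n\<^esub> qB_bar n y"
    using qB_bar_class[OF carrier_plus[OF p(1) r(1)]]
    by (simp only: p(2) r(2) qB_class_add closed qB_bar_class free_bar.hom_add)
next
  show "qB_bar n \<one>\<^bsub>qBrauer n\<^esub> = \<one>\<^bsub>qBrauer n\<^esub>"
    using qB_bar_class[OF carrier_one] by (simp add: qB_class_one free_bar.hom_one)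
qed

lemma qB_bar_scalar: "qB_bar n (qB_scalar n c) = qB_scalar n (qz_bar c)"
  by (simp add: qB_scalar_def qB_bar_class carrier_scal free_bar_scal)

lemma qB_scalar_closed: "qB_scalar n c \<in> carrier (qBrauer n)"
  by (simp add: qB_scalar_def carrier_qBrauer carrier_scal)

lemma qB_scalar_hom:
  "qB_scalar n (a + b) = qB_scalar n a \<oplus>\<^bsub>qBrauer n\<^esub> qB_scalar n b"
  "qB_scalar n (a * b) = qB_scalar n a \<otimes>\<^bsub>qBrauer n\<^esub> qB_scalar n b"
  "qB_scalar n 1 = \<one>\<^bsub>qBrauer n\<^esub>"
  by (simp_all add: qB_scalar_def scal.hom_add scal.hom_mult scal.hom_one qB_class_add qB_class_mult
      qB_class_one carrier_scal)

text \<open>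
  A ring homomorphism may move the scalars, as the bar does, so its values on them have to be
  determined as well. Rational constants, $q$ and $z$ suffice for that, because homomorphisms
  preserve inverses and these elements generate the field.
\<close>

lemma qBrauer_hom_ext:
  assumes S: "ring S"
    and f: "f \<in> ring_hom (qBrauer n) S" and g: "g \<in> ring_hom (qBrauer n) S"
    and rat: "\<And>r. f (qB_scalar n (rat_const r)) = g (qB_scalar n (rat_const r))"
    and q: "f (qB_scalar n qvar) = g (qB_scalar n qvar)"
    and z: "f (qB_scalar n zvar) = g (qB_scalar n zvar)"
    and H: "\<And>i. 1 \<le> i \<Longrightarrow> i < n \<Longrightarrow> f (qB_H n i) = g (qB_H n i)"
    and e: "f (qB_e n) = g (qB_e n)"
    and x: "x \<in> carrier (qBrauer n)"
  shows "f x = g x"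
proof -
  interpret S: ring S by (rule S)
  note hom = ring_hom_add[OF f] ring_hom_add[OF g] ring_hom_mult[OF f] ring_hom_mult[OF g]
    ring_hom_one[OF f] ring_hom_one[OF g]
  have scalar: "f (qB_scalar n c) = g (qB_scalar n c)" for c
  proof (induction c rule: qz_induct)
    case (inverse c)
    have closed: "h (qB_scalar n y) \<in> carrier S" if "h \<in> ring_hom (qBrauer n) S" for h y
      using ring_hom_closed[OF that qB_scalar_closed] .
    have unit: "h (qB_scalar n y) \<otimes>\<^bsub>S\<^esub> h (qB_scalar n y') = \<one>\<^bsub>S\<^esub>"
      if "h \<in> ring_hom (qBrauer n) S" "y * y' = 1" for h y y'
    proof -
      have "h (qB_scalar n y) \<otimes>\<^bsub>S\<^esub> h (qB_scalar n y') = h (qB_scalar n (y * y'))"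
        by (simp only: qB_scalar_hom(2) ring_hom_mult[OF that(1) qB_scalar_closed qB_scalar_closed])
      then show ?thesis
        by (simp only: that(2) qB_scalar_hom(3) ring_hom_one[OF that(1)])
    qed
    show ?case
    proof (rule S.inv_unique)
      show "f (qB_scalar n (inverse c)) \<otimes>\<^bsub>S\<^esub> f (qB_scalar n c) = \<one>\<^bsub>S\<^esub>"
        using unit[OF f] inverse(1) by simp
      show "f (qB_scalar n c) \<otimes>\<^bsub>S\<^esub> g (qB_scalar n (inverse c)) = \<one>\<^bsub>S\<^esub>"
        using unit[OF g] inverse by simp
    qed (simp_all add: closed f g)
  qed (simp_all add: rat q z hom qB_scalar_hom qB_scalar_closed)
  obtain p where p: "p \<in> carrier (free_alg n)" "x = qB_class n p"
    using x by (auto simp: carrier_qBrauer)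
  have "f (qB_class n p) = g (qB_class n p)"
    using p(1)
  proof (induction p rule: free_alg_induct)
    case (scal c)
    show ?case using scalar[of c] by (simp add: qB_scalar_def)
  next
    case (gen a)
    then show ?case
      by (cases rule: gens_cases) (use H e in \<open>simp_all add: qB_H_def qB_e_def\<close>)
  qed (simp_all add: qB_class_add qB_class_mult hom carrier_qBrauer)
  then show ?thesis
    by (simp add: p(2))
qed

theorem lemma3p2:
  fixes n :: nat
  assumes "n \<ge> 2"
  shows "\<exists>!f :: nc_poly set \<Rightarrow> nc_poly set.
           f \<in> extensional (carrier (qBrauer n)) \<and>
           f \<in> ring_hom (qBrauer n) (qBrauer n) \<and>
           (\<forall>x \<in> carrier (qBrauer n). f (f x) = x) \<and>
           (\<forall>r :: rat. \<forall>x \<in> carrier (qBrauer n).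
              f (qB_smult n (rat_const r) x) = qB_smult n (rat_const r) (f x)) \<and>
           f (qB_scalar n qvar) = qB_scalar n (inverse qvar) \<and>
           f (qB_scalar n zvar) = qB_scalar n (inverse zvar) \<and>
           (\<forall>i \<in> {1..n - 1}. f (qB_H n i) = inv\<^bsub>qBrauer n\<^esub> (qB_H n i)) \<and>
           f (qB_e n) = qB_e n"
  (is "\<exists>!f. ?bar f")
proof (rule ex1I)
  interpret B: ring "qBrauer n" by (rule qBrauer_ring)
  have ext: "qB_bar n \<in> extensional (carrier (qBrauer n))"
    by (simp add: qB_bar_def)
  have inv: "qB_bar n (qB_bar n x) = x" if "x \<in> carrier (qBrauer n)" for x
  proof -
    obtain p where p: "p \<in> carrier (free_alg n)" and x: "x = qB_class n p"
      using \<open>x \<in> carrier (qBrauer n)\<close> unfolding carrier_qBrauer by blast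
    show ?thesis
      by (simp only: x qB_bar_class p free_bar_closed free_bar_involution[OF p])
  qed
  have lin: "qB_bar n (qB_smult n (rat_const r) x) = qB_smult n (rat_const r) (qB_bar n x)"
    if "x \<in> carrier (qBrauer n)" for r x
    by (simp only: qB_smult_def qB_bar_scalar qz_bar_simps ring_hom_mult[OF qB_bar_hom qB_scalar_closed that])
  have H: "qB_bar n (qB_H n i) = inv\<^bsub>qBrauer n\<^esub> (qB_H n i)" if "1 \<le> i" "i < n" for i
    unfolding qB_H_inv(1)[OF that]
    by (simp only: qB_H_def qB_bar_class carrier_Hp[OF that] free_bar_Hp)
  have e: "qB_bar n (qB_e n) = qB_e n"
    by (simp only: qB_e_def qB_bar_class carrier_Ep free_bar_Ep)
  show "?bar (qB_bar n)"
  proof (intro conjI ballI allI)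
    show "qB_bar n (qB_H n i) = inv\<^bsub>qBrauer n\<^esub> (qB_H n i)" if "i \<in> {1..n - 1}" for i
      using that by (intro H) auto
  qed (simp_all only: ext qB_bar_hom inv lin e qB_bar_scalar qz_bar_simps)
  fix f
  assume f: "?bar f"
  then have f_hom: "f \<in> ring_hom (qBrauer n) (qBrauer n)"
    by blast
  \<comment> \<open>Linearity over the rationals, applied to the unit.\<close>
  have f_rat: "f (qB_scalar n (rat_const r)) = qB_scalar n (rat_const r)" for r
  proof -
    have "f (qB_smult n (rat_const r) \<one>\<^bsub>qBrauer n\<^esub>) = qB_smult n (rat_const r) (f \<one>\<^bsub>qBrauer n\<^esub>)"
      using f B.one_closed by blast
    then show ?thesis
      by (simp only: qB_smult_def ring_hom_one[OF f_hom] B.r_one qB_scalar_closed)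
  qed
  have f_H: "f (qB_H n i) = inv\<^bsub>qBrauer n\<^esub> (qB_H n i)" if "1 \<le> i" "i < n" for i
    using f that by auto
  show "f = qB_bar n"
  proof (rule extensionalityI[OF _ ext])
    show "f \<in> extensional (carrier (qBrauer n))"
      using f by blast
    show "f x = qB_bar n x" if "x \<in> carrier (qBrauer n)" for x
      using qBrauer_ring f_hom qB_bar_hom _ _ _ _ _ that
    proof (rule qBrauer_hom_ext)
      show "f (qB_scalar n qvar) = qB_bar n (qB_scalar n qvar)"
        "f (qB_scalar n zvar) = qB_bar n (qB_scalar n zvar)"
        "f (qB_e n) = qB_bar n (qB_e n)"
        using f by (simp_all only: qB_bar_scalar qz_bar_simps e)
    qed (simp_all only: f_rat f_H H qB_bar_scalar qz_bar_simps)
  qed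
qed

end
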